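(* Let $\alpha_0>0$ be irrational and $\Delta$ as in the context. (a) If $\alpha_0$ is either not a Liouville number or a hypo-exponential Liouville number, then $\Delta$ satisfies the Lipschitz condition of infinite order at $x=\alpha_0$. (b) If $1<\theta(\alpha_0)<\Delta(\alpha_0)$, then $\Delta$ satisfies the Lipschitz condition of order $\log\Delta(\alpha_0)/\log\theta(\alpha_0)$ at $x=\alpha_0$.
   Context: For real $\beta>1$, $T_\beta(x)=\beta x\bmod 1$ on $[0,1]$ and $d_\beta(1)=(x_i)_{i\ge1}$, $x_i=\lfloor\beta T_\beta^{i-1}(1)\rfloor$ (finite if ending in zeros, trailing zeros omitted). For coprime $0<p<q$, $t'_{p,q}=a'_0\cdots a'_{q-1}$ with $a'_i=\lceil (i+1)p/q\rceil-\lceil ip/q\rceil$ factors as $1z_{p,q}0$ (central word). For irrational $\gamma\in(0,1)$, $(\lceil\gamma(n+1)\rceil-\lceil\gamma n\rceil)_{n\ge0}=1c_\gamma$ (characteristic word). Over $\{b-1,b\}$ means $0\mapsto b-1$, $1\mapsto b$. $\Delta:[0,\infty)\to\mathbb R$: $\Delta(0)=1$; $\Delta(b)=b+1$ for integers $b\ge1$; for $\alpha\in(b-1,b)$, $\Delta(\alpha)$ is the unique $\beta>1$ with $d_\beta(1)=b\,c_{\alpha-b+1}$ (irrational $\alpha$) resp. $d_\beta(1)=b\,z_{p,q}\,b$ when $\alpha-b+1=p/q$ in lowest terms, words over $\{b-1,b\}$. $\|t\|=\min_{n\in\mathbb Z}|t-n|$. For irrational $\alpha$: $\mu(\alpha)=\sup\{\nu:\liminf_{q\to\infty}q^{\nu-1}\|q\alpha\|=0\}$,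 $\theta(\alpha)=\sup\{\lambda:\liminf_{q\to\infty}\frac{\lambda^q}{q}\|q\alpha\|=0\}$. $\alpha$ is Liouville iff $\mu(\alpha)=\infty$; a Liouville number is hypo-exponential if $\theta(\alpha)=1$. A real function $f$ satisfies the Lipschitz condition of order $\eta$ at $x_0$ if $\eta$ is the supremum of all $\zeta$ for which there is a constant $C$ with $|f(x)-f(x_0)|\le C|x-x_0|^\zeta$ for all $x$ in some open interval containing $x_0$. *)

theory Defs
  imports "HOL-Analysis.Analysis"
begin

text \<open>Beta-expansion of 1. All sequences are indexed from 0, so \<open>beta_digit \<beta> i\<close> is the
  digit $x_{i+1}$. The map is only meant on $[0,1]$.\<close>

definition beta_map :: "real \<Rightarrow> real \<Rightarrow> real" where
  "beta_map \<beta> x = frac (\<beta> * x)"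

definition beta_digit :: "real \<Rightarrow> nat \<Rightarrow> int" where
  "beta_digit \<beta> i = \<lfloor>\<beta> * (beta_map \<beta> ^^ i) 1\<rfloor>"

datatype word = Finite "int list" | Infinite "nat \<Rightarrow> int"

definition beta_expansion :: "real \<Rightarrow> word" where
  "beta_expansion \<beta> =
     (if \<exists>n. \<forall>i\<ge>n. beta_digit \<beta> i = 0
      then Finite (map (beta_digit \<beta>) [0..<(LEAST n. \<forall>i\<ge>n. beta_digit \<beta> i = 0)])
      else Infinite (beta_digit \<beta>))"

definition upper_mechanical :: "real \<Rightarrow> nat \<Rightarrow> int" where
  "upper_mechanical \<gamma> n = \<lceil>\<gamma> * real (n + 1)\<rceil> - \<lceil>\<gamma> * real n\<rceil>"

definition characteristic_word :: "real \<Rightarrow> nat \<Rightarrow> int" where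
  "characteristic_word \<gamma> n = upper_mechanical \<gamma> (Suc n)"

definition christoffel_word :: "nat \<Rightarrow> nat \<Rightarrow> int list" where
  "christoffel_word p q = map (upper_mechanical (real p / real q)) [0..<q]"

definition central_word :: "nat \<Rightarrow> nat \<Rightarrow> int list" where
  "central_word p q = butlast (tl (christoffel_word p q))"

lemma upper_mechanical_0:
  assumes "0 < \<gamma>" "\<gamma> < 1"
  shows "upper_mechanical \<gamma> 0 = 1"
  using assms by (simp add: upper_mechanical_def ceiling_eq_iff)

lemma christoffel_word_factor:
  assumes "0 < p" "p < q"
  shows "christoffel_word p q = 1 # central_word p q @ [0]"
proof -
  let ?\<gamma> = "real p / real q"
  obtain r where q: "q = Suc (Suc r)"
    using assms by (metis less_antisym less_nat_zero_code not0_implies_Suc)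
  have "\<lceil>?\<gamma> * real (Suc r)\<rceil> = int p"
    using assms unfolding ceiling_eq_iff q by (simp add: field_simps)
  moreover have "?\<gamma> * real (Suc r + 1) = real p"
    unfolding q by (simp add: field_simps)
  ultimately have last: "upper_mechanical ?\<gamma> (Suc r) = 0"
    unfolding upper_mechanical_def by simp
  have first: "upper_mechanical ?\<gamma> 0 = 1"
    using assms by (intro upper_mechanical_0) auto
  have "[0..<q] = 0 # [1..<Suc r] @ [Suc r]"
    unfolding q by (simp add: upt_rec[of 0])
  then have "christoffel_word p q = 1 # map (upper_mechanical ?\<gamma>) [1..<Suc r] @ [0]"
    using first last by (simp add: christoffel_word_def)
  then show ?thesis
    by (simp add: central_word_def)
qed

text \<open>The recoding $0 \mapsto b-1$, $1 \mapsto b$ of a letter.\<close>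

definition over :: "int \<Rightarrow> int \<Rightarrow> int" where
  "over b a = b - 1 + a"

text \<open>Only meant for $\alpha \ge 0$. For non-integral \<open>\<alpha>\<close>, \<open>b = \<lceil>\<alpha>\<rceil>\<close> is the integer with
  $\alpha \in (b-1,b)$.\<close>

definition Delta :: "real \<Rightarrow> real" where
  "Delta \<alpha> =
     (if \<alpha> = 0 then 1
      else if \<alpha> \<in> \<int> then \<alpha> + 1
      else let b = \<lceil>\<alpha>\<rceil>; \<gamma> = \<alpha> - real_of_int b + 1 in
        if \<alpha> \<notin> \<rat> then
          (THE \<beta>. \<beta> > 1 \<and>
             beta_expansion \<beta> = Infinite (case_nat b (\<lambda>n. over b (characteristic_word \<gamma> n))))
        else
          (THE \<beta>. \<beta> > 1 \<and>
             (\<exists>p q. 0 < p \<and> p < q \<and> coprime p q \<and> \<gamma> = real p / real q \<and>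
                beta_expansion \<beta> = Finite (b # map (over b) (central_word p q) @ [b]))))"

definition dist_int :: "real \<Rightarrow> real" where
  "dist_int t = (INF n::int. \<bar>t - real_of_int n\<bar>)"

lemma dist_int_round: "dist_int t = \<bar>t - real_of_int (round t)\<bar>"
  unfolding dist_int_def
  by (rule cInf_eq_minimum)
     (auto intro: round_diff_minimal)

definition irrationality_exponent :: "real \<Rightarrow> ereal" where
  "irrationality_exponent \<alpha> =
     (SUP \<nu> \<in> {\<nu>::real. liminf (\<lambda>q::nat. ereal (real q powr (\<nu> - 1) * dist_int (real q * \<alpha>))) = 0}.
        ereal \<nu>)"

definition irrationality_base :: "real \<Rightarrow> ereal" where
  "irrationality_base \<alpha> =
     (SUP l \<in> {l::real. liminf (\<lambda>q::nat. ereal (l ^ q / real q * dist_int (real q * \<alpha>))) = 0}.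
        ereal l)"

definition liouville :: "real \<Rightarrow> bool" where
  "liouville \<alpha> \<longleftrightarrow> \<alpha> \<notin> \<rat> \<and> irrationality_exponent \<alpha> = \<infinity>"

definition hypo_exponential_liouville :: "real \<Rightarrow> bool" where
  "hypo_exponential_liouville \<alpha> \<longleftrightarrow> liouville \<alpha> \<and> irrationality_base \<alpha> = 1"

text \<open>Since \<open>0 powr \<zeta> = 0\<close> for every \<open>\<zeta>\<close>, the inequality is vacuous at \<open>x = x\<^sub>0\<close>.\<close>

definition lipschitz_condition_at :: "ereal \<Rightarrow> (real \<Rightarrow> real) \<Rightarrow> real \<Rightarrow> bool" where
  "lipschitz_condition_at \<eta> f x\<^sub>0 \<longleftrightarrow>
     \<eta> = (SUP \<zeta> \<in> {\<zeta>::real. \<exists>C u v. u < x\<^sub>0 \<and> x\<^sub>0 < v \<and>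
                  (\<forall>x\<in>{u<..<v}. \<bar>f x - f x\<^sub>0\<bar> \<le> C * \<bar>x - x\<^sub>0\<bar> powr \<zeta>)}. ereal \<zeta>)"

end

theory Submission
  imports Defs "HOL-Real_Asymp.Real_Asymp"
begin

text \<open>For non-integral \<open>\<alpha> > 0\<close>, rational or not, \<open>\<beta> = Delta \<alpha>\<close> is the unique \<open>\<beta> > 1\<close> such that
  \<open>t = 1 / \<beta>\<close> satisfies \<open>(\<Sum>n. (\<lceil>\<alpha>(n+1)\<rceil> - \<lceil>\<alpha>n\<rceil>) t\<^sup>n\<^sup>+\<^sup>1) = 1\<close>, equivalently
  \<open>(1 - t) (\<Sum>n. \<lceil>\<alpha>n\<rceil> t\<^sup>n) = 1\<close>; in the rational case the periodic series is the infinite form of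
  the finite expansion. This series is bi-Lipschitz in \<open>t\<close>, locally uniformly in \<open>\<alpha>\<close>, so up to
  constants \<open>\<bar>Delta \<alpha> - Delta \<alpha>\<^sub>0\<bar>\<close> is \<open>\<bar>\<Sum>n. (\<lceil>\<alpha>n\<rceil> - \<lceil>\<alpha>\<^sub>0n\<rceil>) t\<^sub>0\<^sup>n\<bar>\<close>, whose terms all have the same
  sign. The \<open>n\<close>-th term is nonzero only if the distance of \<open>n\<alpha>\<^sub>0\<close> to the nearest integer is at most
  \<open>n \<bar>\<alpha> - \<alpha>\<^sub>0\<bar>\<close>, which forces \<open>l\<^sup>-\<^sup>n \<le> const \<bar>\<alpha> - \<alpha>\<^sub>0\<bar>\<close> for each \<open>l\<close> above the irrationality base;
  conversely, when \<open>l\<close> lies below it, good approximations with denominator \<open>q\<close> produce points at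
  distance \<open>l\<^sup>-\<^sup>q\<close> from \<open>\<alpha>\<^sub>0\<close> whose \<open>q\<close>-th term is nonzero.\<close>

subsection \<open>Mechanical words and their power series\<close>

lemma upper_mechanical_bounds:
  assumes "\<alpha> \<ge> 0"
  shows "0 \<le> upper_mechanical \<alpha> n" and "real_of_int (upper_mechanical \<alpha> n) \<le> \<alpha> + 1"
proof -
  show "0 \<le> upper_mechanical \<alpha> n"
    unfolding upper_mechanical_def using assms by (simp add: ceiling_mono mult_left_mono)
  have "real_of_int \<lceil>\<alpha> * real (n + 1)\<rceil> \<le> \<alpha> * real (n + 1) + 1"
    by linarith
  moreover have "\<alpha> * real n \<le> real_of_int \<lceil>\<alpha> * real n\<rceil>"
    by linarith
  moreover have "\<alpha> * real (n + 1) = \<alpha> * real n + \<alpha>"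
    by (simp add: algebra_simps)
  ultimately show "real_of_int (upper_mechanical \<alpha> n) \<le> \<alpha> + 1"
    unfolding upper_mechanical_def of_int_diff by linarith
qed

text \<open>Shifting the slope by an integer shifts every letter, which is exactly the recoding
  \<open>over\<close>. Words over {b-1, b} can therefore be handled as mechanical words of slope
  \<alpha> itself.\<close>

lemma upper_mechanical_add_int:
  "upper_mechanical (\<gamma> + of_int k) n = upper_mechanical \<gamma> n + k"
proof -
  have "\<lceil>(\<gamma> + of_int k) * real m\<rceil> = \<lceil>\<gamma> * real m\<rceil> + k * int m" for m
    using ceiling_add_of_int[of "\<gamma> * real m" "k * int m"] by (simp add: algebra_simps)
  from this[of n] this[of "n + 1"] show ?thesis
    unfolding upper_mechanical_def by (simp add: distrib_left)
qed

text \<open>Vanishing letters would freeze the ceilings from some index on, while \<alpha> n is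
  unbounded.\<close>

lemma upper_mechanical_not_eventually_0:
  assumes "\<alpha> > 0"
  shows "\<exists>i\<ge>n. upper_mechanical \<alpha> i \<noteq> 0"
proof (rule ccontr)
  assume "\<not> ?thesis"
  then have z: "upper_mechanical \<alpha> i = 0" if "i \<ge> n" for i
    using that by blast
  have eq: "\<lceil>\<alpha> * real (n + k)\<rceil> = \<lceil>\<alpha> * real n\<rceil>" for k
  proof (induction k)
    case (Suc k)
    then show ?case
      using z[of "n + k"] by (simp add: upper_mechanical_def algebra_simps)
  qed simp
  obtain k :: nat where k: "\<alpha> * real k > real_of_int \<lceil>\<alpha> * real n\<rceil>"
    using reals_Archimedean3[OF assms] by (metis mult.commute)
  have "\<alpha> * real k \<le> \<alpha> * real (n + k)"
    using assms by simp
  also have "\<dots> \<le> of_int \<lceil>\<alpha> * real n\<rceil>"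
    using eq[of k] le_of_int_ceiling[of "\<alpha> * real (n + k)"] by simp
  finally show False
    using k by simp
qed

text \<open>For t = 1/\<beta> this is the value in base \<beta> of the word shifted by i, the
  candidate for the i-th point of the orbit of 1 under \<open>beta_map \<beta>\<close>.\<close>

definition mechanical_tail :: "real \<Rightarrow> nat \<Rightarrow> real \<Rightarrow> real" where
  "mechanical_tail \<alpha> i t = (\<Sum>n. of_int (upper_mechanical \<alpha> (i + n)) * t ^ Suc n)"

abbreviation mechanical_series :: "real \<Rightarrow> real \<Rightarrow> real" where
  "mechanical_series \<alpha> \<equiv> mechanical_tail \<alpha> 0"

lemma summable_of_nat_mult_power:
  fixes t :: real
  assumes "0 \<le> t" "t < 1"
  shows "summable (\<lambda>n. real (Suc n) * t ^ n)"
  using geometric_deriv_sums[of t] assms by (auto simp: sums_iff)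

lemma summable_upper_mechanical:
  fixes \<alpha> t :: real
  assumes "\<alpha> \<ge> 0" "0 \<le> t" "t < 1"
  shows "summable (\<lambda>n. of_int (upper_mechanical \<alpha> (i + n)) * t ^ Suc n)"
proof (rule summable_comparison_test')
  show "summable (\<lambda>n. (\<alpha> + 1) * (t * t ^ n))"
    using assms by (intro summable_mult summable_geometric) auto
  show "norm (of_int (upper_mechanical \<alpha> (i + n)) * t ^ Suc n) \<le> (\<alpha> + 1) * (t * t ^ n)" for n
    using upper_mechanical_bounds[OF assms(1), of "i + n"] assms
    by (simp add: abs_mult mult_right_mono)
qed

lemma summable_ceiling_mult_power:
  fixes \<alpha> t :: real
  assumes "\<alpha> \<ge> 0" "0 \<le> t" "t < 1"
  shows "summable (\<lambda>n. of_int \<lceil>\<alpha> * real (i + n)\<rceil> * t ^ n)"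
proof (rule summable_comparison_test')
  show "summable (\<lambda>n. (\<alpha> * real i + \<alpha> + 1) * (real (Suc n) * t ^ n))"
    using assms by (intro summable_mult summable_of_nat_mult_power)
  fix n
  have "0 \<le> \<alpha> * real (i + n)"
    using assms by simp
  then have "0 \<le> \<lceil>\<alpha> * real (i + n)\<rceil>"
    by linarith
  have "of_int \<lceil>\<alpha> * real (i + n)\<rceil> \<le> \<alpha> * real (i + n) + 1"
    by linarith
  also have "\<dots> \<le> (\<alpha> * real i + \<alpha> + 1) * real (Suc n)"
    using assms by (simp add: algebra_simps)
  finally show "norm (of_int \<lceil>\<alpha> * real (i + n)\<rceil> * t ^ n) \<le>
      (\<alpha> * real i + \<alpha> + 1) * (real (Suc n) * t ^ n)"
    using assms \<open>0 \<le> \<lceil>\<alpha> * real (i + n)\<rceil>\<close>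
    by (simp add: abs_mult mult_right_mono flip: mult.assoc)
qed

lemma suminf_diff_ge_term:
  fixes f g :: "nat \<Rightarrow> real"
  assumes "summable f" "summable g" "\<And>n. f n \<le> g n"
  shows "g i - f i \<le> suminf g - suminf f"
proof -
  have "summable (\<lambda>n. g n - f n)"
    using assms by (intro summable_diff)
  then have "(\<Sum>n\<in>{i}. g n - f n) \<le> (\<Sum>n. g n - f n)"
    using assms by (intro sum_le_suminf) auto
  then show ?thesis
    using suminf_diff[OF assms(2,1)] by simp
qed

text \<open>Summation by parts; \<open>c 0 = 0\<close> removes the boundary term.\<close>

lemma suminf_diff_mult_power:
  fixes c :: "nat \<Rightarrow> real"
  assumes "summable (\<lambda>n. c n * t ^ n)" "c 0 = 0"
  shows "(\<Sum>n. (c (Suc n) - c n) * t ^ Suc n) = (1 - t) * (\<Sum>n. c n * t ^ n)"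
proof -
  let ?S = "\<Sum>n. c n * t ^ n"
  have "(\<lambda>n. c (Suc n) * t ^ Suc n) sums ?S"
    using assms sums_Suc_iff[of "\<lambda>n. c n * t ^ n" ?S] by (simp add: summable_sums)
  moreover have "(\<lambda>n. t * (c n * t ^ n)) sums (t * ?S)"
    using assms by (intro sums_mult summable_sums)
  ultimately have "(\<lambda>n. c (Suc n) * t ^ Suc n - t * (c n * t ^ n)) sums (?S - t * ?S)"
    by (rule sums_diff)
  then show ?thesis
    by (simp add: sums_iff algebra_simps)
qed

lemma summable_ceiling_diff:
  fixes \<alpha> t :: real
  assumes "\<alpha> \<ge> 0" "0 \<le> t" "t < 1"
  shows "summable (\<lambda>n. of_int (\<lceil>\<alpha> * real (i + n)\<rceil> - \<lceil>\<alpha> * real i\<rceil>) * t ^ n)"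
proof -
  have "summable (\<lambda>n. of_int \<lceil>\<alpha> * real (i + n)\<rceil> * t ^ n - of_int \<lceil>\<alpha> * real i\<rceil> * t ^ n)"
    using assms by (intro summable_diff summable_mult summable_ceiling_mult_power summable_geometric) auto
  then show ?thesis
    by (simp add: algebra_simps)
qed

text \<open>Letters are differences of consecutive ceilings, so summation by parts leaves only
  ceilings, for which monotonicity in \<alpha> and subadditivity are available.\<close>

lemma mechanical_tail_eq_ceiling_sum:
  assumes "\<alpha> \<ge> 0" "0 \<le> t" "t < 1"
  shows "mechanical_tail \<alpha> i t =
    (1 - t) * (\<Sum>n. of_int (\<lceil>\<alpha> * real (i + n)\<rceil> - \<lceil>\<alpha> * real i\<rceil>) * t ^ n)"
  using suminf_diff_mult_power[OF summable_ceiling_diff[OF assms, of i]]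
  by (simp add: mechanical_tail_def upper_mechanical_def add_ac)

lemma mechanical_series_eq_ceiling_sum:
  assumes "\<alpha> \<ge> 0" "0 \<le> t" "t < 1"
  shows "mechanical_series \<alpha> t = (1 - t) * (\<Sum>n. of_int \<lceil>\<alpha> * real n\<rceil> * t ^ n)"
  using mechanical_tail_eq_ceiling_sum[OF assms, of 0] by simp

lemma mechanical_tail_rec:
  assumes "\<alpha> \<ge> 0" "0 \<le> t" "t < 1"
  shows "mechanical_tail \<alpha> i t = t * (of_int (upper_mechanical \<alpha> i) + mechanical_tail \<alpha> (Suc i) t)"
proof -
  have "mechanical_tail \<alpha> i t = of_int (upper_mechanical \<alpha> i) * t +
      (\<Sum>n. of_int (upper_mechanical \<alpha> (i + Suc n)) * t ^ Suc (Suc n))"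
    unfolding mechanical_tail_def
    using suminf_split_head[OF summable_upper_mechanical[OF assms, of i]] by simp
  also have "(\<Sum>n. of_int (upper_mechanical \<alpha> (i + Suc n)) * t ^ Suc (Suc n)) =
      (\<Sum>n. t * (of_int (upper_mechanical \<alpha> (Suc i + n)) * t ^ Suc n))"
    by (simp add: mult_ac)
  also have "\<dots> = t * mechanical_tail \<alpha> (Suc i) t"
    unfolding mechanical_tail_def by (rule suminf_mult[OF summable_upper_mechanical[OF assms]])
  finally show ?thesis
    by (simp add: algebra_simps)
qed

lemma mechanical_tail_nonneg:
  assumes "\<alpha> \<ge> 0" "0 \<le> t" "t < 1"
  shows "0 \<le> mechanical_tail \<alpha> i t"
  unfolding mechanical_tail_def
  using assms upper_mechanical_bounds(1)
  by (intro suminf_nonneg summable_upper_mechanical) auto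

text \<open>The defect k \<lceil>x\<rceil> - k x grows linearly in k unless x is an integer, but a
  ceiling exceeds its argument by less than 1.\<close>

lemma ceiling_multiple_all_imp_int:
  assumes "\<And>k::nat. \<lceil>x * real k\<rceil> = int k * \<lceil>x\<rceil>"
  shows "x \<in> \<int>"
proof (rule ccontr)
  assume "x \<notin> \<int>"
  then have pos: "of_int \<lceil>x\<rceil> - x > 0"
    by (metis Ints_of_int le_of_int_ceiling diff_gt_0_iff_gt order_le_less)
  obtain k :: nat where "real k * (of_int \<lceil>x\<rceil> - x) > 1"
    using reals_Archimedean3[OF pos] by blast
  then have "real k * of_int \<lceil>x\<rceil> > x * real k + 1"
    by (simp add: algebra_simps)
  moreover have "real_of_int \<lceil>x * real k\<rceil> = real k * of_int \<lceil>x\<rceil>"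
    using assms[of k] by simp
  ultimately show False
    by linarith
qed

lemma ceiling_add_diff_le: "\<lceil>x + y\<rceil> - \<lceil>x\<rceil> \<le> \<lceil>y :: real\<rceil>"
  using ceiling_add_le[of x y] by linarith

text \<open>Subadditivity of the ceiling function replaces the lexicographic comparison of the
  word with its shifts.\<close>

lemma mechanical_tail_less_series:
  assumes "\<alpha> > 0" "0 < t" "t < 1" "\<alpha> * real i \<notin> \<int>"
  shows "mechanical_tail \<alpha> i t < mechanical_series \<alpha> t"
proof -
  \<comment> \<open>If no n gave a strict inequality, the ceiling would be additive at i and every
    n, hence linear along the multiples of i, and \<alpha> i would be an integer.\<close>
  obtain n where n: "\<lceil>\<alpha> * real (i + n)\<rceil> - \<lceil>\<alpha> * real i\<rceil> < \<lceil>\<alpha> * real n\<rceil>"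
  proof (rule ccontr)
    assume *: "\<not> thesis"
    have eq: "\<lceil>\<alpha> * real (i + n)\<rceil> = \<lceil>\<alpha> * real i\<rceil> + \<lceil>\<alpha> * real n\<rceil>" for n
      using * that[of n] ceiling_add_diff_le[of "\<alpha> * real i" "\<alpha> * real n"]
      by (force simp: algebra_simps)
    have "\<lceil>\<alpha> * real (k * i)\<rceil> = int k * \<lceil>\<alpha> * real i\<rceil>" for k
    proof (induction k)
      case (Suc k)
      then show ?case
        using eq[of "k * i"] by (simp add: algebra_simps)
    qed simp
    then have "\<alpha> * real i \<in> \<int>"
      by (intro ceiling_multiple_all_imp_int) (simp add: mult_ac)
    then show False
      using assms by simp
  qed
  let ?f = "\<lambda>n. real_of_int (\<lceil>\<alpha> * real (i + n)\<rceil> - \<lceil>\<alpha> * real i\<rceil>) * t ^ n"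
  let ?g = "\<lambda>n. real_of_int \<lceil>\<alpha> * real n\<rceil> * t ^ n"
  have "?f m \<le> ?g m" for m
    using assms ceiling_add_diff_le[of "\<alpha> * real i" "\<alpha> * real m"]
    by (intro mult_right_mono) (auto simp: algebra_simps simp flip: of_int_diff of_int_add)
  then have "?g n - ?f n \<le> suminf ?g - suminf ?f"
    using assms summable_ceiling_mult_power[of \<alpha> t 0]
    by (intro suminf_diff_ge_term summable_ceiling_diff) auto
  moreover have "?f n < ?g n"
    using assms n by (intro mult_strict_right_mono) (auto simp del: of_int_diff)
  ultimately have "suminf ?f < suminf ?g"
    by linarith
  then show ?thesis
    using assms mechanical_tail_eq_ceiling_sum[of \<alpha> t i] mechanical_series_eq_ceiling_sum[of \<alpha> t]
    by simp
qed

section \<open>Growth and regularity of the series in t\<close>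

lemma mechanical_series_0 [simp]: "mechanical_series \<alpha> 0 = 0"
  by (simp add: mechanical_tail_def)

text \<open>All terms increase with t, and the first one has the coefficient
  \<lceil>\<alpha>\<rceil>, which is at least 1.\<close>

lemma mechanical_series_diff_ge:
  assumes "\<alpha> > 0" "0 \<le> s" "s \<le> t" "t < 1"
  shows "t - s \<le> mechanical_series \<alpha> t - mechanical_series \<alpha> s"
proof -
  have "1 \<le> \<lceil>\<alpha>\<rceil>"
    using assms by linarith
  then have "1 * (t - s) \<le> of_int \<lceil>\<alpha>\<rceil> * (t - s)"
    using assms by (intro mult_right_mono) auto
  also have "\<dots> = of_int (upper_mechanical \<alpha> (0 + 0)) * t ^ Suc 0 -
      of_int (upper_mechanical \<alpha> (0 + 0)) * s ^ Suc 0"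
    by (simp add: upper_mechanical_def algebra_simps)
  also have "\<dots> \<le> mechanical_series \<alpha> t - mechanical_series \<alpha> s"
    unfolding mechanical_tail_def
  proof (rule suminf_diff_ge_term)
    fix n
    show "of_int (upper_mechanical \<alpha> (0 + n)) * s ^ Suc n \<le>
        of_int (upper_mechanical \<alpha> (0 + n)) * t ^ Suc n"
      using assms upper_mechanical_bounds(1)[of \<alpha> n]
      by (intro mult_left_mono power_mono) auto
  qed (use assms in \<open>intro summable_upper_mechanical; simp\<close>)+
  finally show ?thesis
    by simp
qed

lemma power_Suc_diff_le:
  fixes s t r :: real
  assumes "0 \<le> s" "s \<le> t" "t \<le> r"
  shows "t ^ Suc n - s ^ Suc n \<le> real (Suc n) * r ^ n * (t - s)"
proof -
  have "t ^ p * s ^ (n - p) \<le> r ^ n" if "p < Suc n" for p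
  proof -
    have "t ^ p * s ^ (n - p) \<le> r ^ p * r ^ (n - p)"
      using assms by (intro mult_mono power_mono) auto
    then show ?thesis
      using that by (simp flip: power_add)
  qed
  then have "(\<Sum>p<Suc n. t ^ p * s ^ (n - p)) \<le> (\<Sum>p<Suc n. r ^ n)"
    by (intro sum_mono) auto
  then have "(\<Sum>p<Suc n. t ^ p * s ^ (n - p)) * (t - s) \<le> real (Suc n) * r ^ n * (t - s)"
    using assms by (intro mult_right_mono) auto
  moreover have "t ^ Suc n - s ^ Suc n = (\<Sum>p<Suc n. t ^ p * s ^ (n - p)) * (t - s)"
    using diff_power_eq_sum[of t n s] by (simp only: mult.commute)
  ultimately show ?thesis
    by simp
qed

text \<open>The letters are at most A + 1 and the differences of powers at most (n+1) r^n (t - s);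
  summing (n+1) r^n gives a constant that depends on \<alpha> only through A.\<close>

lemma mechanical_series_diff_le:
  assumes "0 \<le> \<alpha>" "\<alpha> \<le> A" "0 \<le> s" "s \<le> t" "t \<le> r" "r < 1"
  shows "mechanical_series \<alpha> t - mechanical_series \<alpha> s \<le> (A + 1) / (1 - r)\<^sup>2 * (t - s)"
proof -
  let ?f = "\<lambda>t n. of_int (upper_mechanical \<alpha> (0 + n)) * t ^ Suc n :: real"
  have sm: "summable (?f t)" "summable (?f s)"
    using assms by (intro summable_upper_mechanical; simp)+
  have "(\<lambda>n. real (Suc n) * r ^ n) sums (1 / (1 - r)\<^sup>2)"
    using geometric_deriv_sums[of r] assms by simp
  then have r: "(\<lambda>n. (A + 1) * (t - s) * (real (Suc n) * r ^ n)) sums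
      ((A + 1) * (t - s) * (1 / (1 - r)\<^sup>2))"
    by (rule sums_mult)
  have "mechanical_series \<alpha> t - mechanical_series \<alpha> s = (\<Sum>n. ?f t n - ?f s n)"
    unfolding mechanical_tail_def by (rule suminf_diff[OF sm])
  also have "\<dots> \<le> (\<Sum>n. (A + 1) * (t - s) * (real (Suc n) * r ^ n))"
  proof (rule suminf_le)
    fix n
    have "?f t n - ?f s n = of_int (upper_mechanical \<alpha> n) * (t ^ Suc n - s ^ Suc n)"
      by (simp add: algebra_simps)
    also have "\<dots> \<le> (A + 1) * (real (Suc n) * r ^ n * (t - s))"
      using assms upper_mechanical_bounds[of \<alpha> n] power_Suc_diff_le[of s t r n]
      by (intro mult_mono) (auto intro: power_mono mult_mono)
    finally show "?f t n - ?f s n \<le> (A + 1) * (t - s) * (real (Suc n) * r ^ n)"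
      by (simp add: mult_ac)
  qed (use sm r in \<open>auto intro: summable_diff simp: sums_iff\<close>)
  also have "\<dots> = (A + 1) / (1 - r)\<^sup>2 * (t - s)"
    using r by (simp add: sums_iff)
  finally show ?thesis .
qed

text \<open>In the ceiling form \<lceil>\<alpha> n\<rceil> is replaced by \<alpha> n, and the series
  of n t^n has a closed form.\<close>

lemma mechanical_series_ge:
  assumes "\<alpha> > 0" "0 \<le> t" "t < 1"
  shows "\<alpha> * t / (1 - t) \<le> mechanical_series \<alpha> t"
proof -
  have "(\<lambda>n. (t * \<alpha>) * (real (Suc n) * t ^ n)) sums ((t * \<alpha>) * (1 / (1 - t)\<^sup>2))"
    using geometric_deriv_sums[of t] assms by (intro sums_mult) auto
  then have "(\<lambda>n. \<alpha> * real (Suc n) * t ^ Suc n) sums (t * \<alpha> / (1 - t)\<^sup>2)"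
    by (simp add: mult_ac)
  then have s: "(\<lambda>n. \<alpha> * real n * t ^ n) sums (t * \<alpha> / (1 - t)\<^sup>2)"
    using sums_Suc_iff[of "\<lambda>n. \<alpha> * real n * t ^ n"] by simp
  have "t * \<alpha> / (1 - t)\<^sup>2 \<le> (\<Sum>n. of_int \<lceil>\<alpha> * real n\<rceil> * t ^ n)"
    using s assms summable_ceiling_mult_power[of \<alpha> t 0]
    by (intro sums_le[OF _ s summable_sums]) (auto intro!: mult_right_mono)
  then have "(1 - t) * (t * \<alpha> / (1 - t)\<^sup>2) \<le> mechanical_series \<alpha> t"
    unfolding mechanical_series_eq_ceiling_sum[OF less_imp_le[OF assms(1)] assms(2,3)]
    using assms by (intro mult_left_mono) auto
  then show ?thesis
    using assms by (simp add: power2_eq_square mult_ac)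
qed

lemma mechanical_series_inj:
  assumes "\<alpha> > 0" "0 \<le> s" "s < 1" "0 \<le> t" "t < 1"
    and "mechanical_series \<alpha> s = mechanical_series \<alpha> t"
  shows "s = t"
  using mechanical_series_diff_ge[of \<alpha> s t] mechanical_series_diff_ge[of \<alpha> t s] assms
  by linarith

lemma mechanical_series_eq_1_exists:
  assumes "\<alpha> > 0"
  obtains t where "0 < t" "t \<le> 1 / (1 + \<alpha>)" "mechanical_series \<alpha> t = 1"
proof -
  \<comment> \<open>This r solves \<alpha> r / (1 - r) = 1, so the lower bound for the series
    already reaches 1 there.\<close>
  define r where "r = 1 / (1 + \<alpha>)"
  have r: "0 < r" "r < 1" and "\<alpha> * r / (1 - r) = 1"
    using assms by (auto simp: r_def field_simps)
  then have ge: "1 \<le> mechanical_series \<alpha> r"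
    using mechanical_series_ge[of \<alpha> r] assms by simp
  let ?K = "(\<alpha> + 1) / (1 - r)\<^sup>2"
  have "?K-lipschitz_on {0..r} (mechanical_series \<alpha>)"
  proof (rule lipschitz_onI)
    have *: "dist (mechanical_series \<alpha> x) (mechanical_series \<alpha> y) \<le> ?K * dist x y"
      if "x \<in> {0..r}" "y \<in> {0..r}" "x \<le> y" for x y
      using mechanical_series_diff_le[of \<alpha> \<alpha> x y r] mechanical_series_diff_ge[of \<alpha> x y]
        that assms r by (simp add: dist_real_def)
    show "dist (mechanical_series \<alpha> x) (mechanical_series \<alpha> y) \<le> ?K * dist x y"
      if "x \<in> {0..r}" "y \<in> {0..r}" for x y
      using *[of x y] *[of y x] that by (cases "x \<le> y") (auto simp: dist_commute)
  qed (use assms in auto)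
  then have "continuous_on {0..r} (mechanical_series \<alpha>)"
    by (rule lipschitz_on_continuous_on)
  then obtain t where t: "0 \<le> t" "t \<le> r" "mechanical_series \<alpha> t = 1"
    using IVT'[of "mechanical_series \<alpha>" 0 1 r] ge r by auto
  moreover have "t \<noteq> 0"
    using t by auto
  ultimately show ?thesis
    using that[of t] by (simp add: r_def)
qed

subsection \<open>Beta-expansions of 1\<close>

lemma beta_orbit_range: "(beta_map \<beta> ^^ i) 1 \<in> {0..1}"
  by (cases i) (auto simp: beta_map_def intro: less_imp_le[OF frac_lt_1])

lemma beta_map_digit:
  "\<beta> * (beta_map \<beta> ^^ i) 1 = of_int (beta_digit \<beta> i) + (beta_map \<beta> ^^ Suc i) 1"
  by (simp add: beta_digit_def beta_map_def frac_def)

lemma beta_digit_partial_sum: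
  assumes "\<beta> > 1"
  shows "(\<Sum>i<n. of_int (beta_digit \<beta> i) * (1 / \<beta>) ^ Suc i) + (beta_map \<beta> ^^ n) 1 * (1 / \<beta>) ^ n = 1"
proof (induction n)
  case (Suc n)
  have "(beta_map \<beta> ^^ n) 1 * (1 / \<beta>) ^ n = \<beta> * (beta_map \<beta> ^^ n) 1 * (1 / \<beta>) ^ Suc n"
    using assms by simp
  also have "\<dots> = of_int (beta_digit \<beta> n) * (1 / \<beta>) ^ Suc n +
      (beta_map \<beta> ^^ Suc n) 1 * (1 / \<beta>) ^ Suc n"
    unfolding beta_map_digit by (simp only: distrib_right)
  finally show ?case
    using Suc by (simp only: sum.lessThan_Suc)
qed simp

text \<open>The orbit stays in [0, 1], so the remainder of the partial sums is at most
  \<beta>^(-n).\<close>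

lemma beta_digit_sums:
  assumes "\<beta> > 1"
  shows "(\<lambda>i. of_int (beta_digit \<beta> i) * (1 / \<beta>) ^ Suc i) sums 1"
proof -
  have lim: "(\<lambda>n. (1 / \<beta>) ^ n) \<longlonglongrightarrow> 0"
    using assms by (intro LIMSEQ_power_zero) auto
  have "(\<lambda>n. (beta_map \<beta> ^^ n) 1 * (1 / \<beta>) ^ n) \<longlonglongrightarrow> 0"
  proof (rule Lim_null_comparison[OF _ lim], rule always_eventually, rule allI)
    fix n
    have "(beta_map \<beta> ^^ n) 1 * (1 / \<beta>) ^ n \<le> 1 * (1 / \<beta>) ^ n"
      using beta_orbit_range[of n \<beta>] assms by (intro mult_right_mono) auto
    then show "norm ((beta_map \<beta> ^^ n) 1 * (1 / \<beta>) ^ n) \<le> (1 / \<beta>) ^ n"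
      using beta_orbit_range[of n \<beta>] assms by (simp add: abs_mult)
  qed
  then have "(\<lambda>n. 1 - (beta_map \<beta> ^^ n) 1 * (1 / \<beta>) ^ n) \<longlonglongrightarrow> 1 - 0"
    by (intro tendsto_intros)
  moreover have "1 - (beta_map \<beta> ^^ n) 1 * (1 / \<beta>) ^ n =
      (\<Sum>i<n. of_int (beta_digit \<beta> i) * (1 / \<beta>) ^ Suc i)" for n
    using beta_digit_partial_sum[OF assms, of n] by linarith
  ultimately show ?thesis
    by (simp add: sums_def)
qed

text \<open>A number in [0, 1) is the fractional part of its sum with any integer, so the recursion
  determines the orbit. The bound m serves finite expansions, where the range condition holds only
  up to index m.\<close>

lemma beta_orbit_eqI:
  assumes "R 0 = 1"
    and "\<And>i. i < m \<Longrightarrow> \<beta> * R i = of_int (x i) + R (Suc i)"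
    and "\<And>i. i < m \<Longrightarrow> 0 \<le> R (Suc i) \<and> R (Suc i) < 1"
    and "i \<le> m"
  shows "(beta_map \<beta> ^^ i) 1 = R i"
  using assms(4)
proof (induction i)
  case (Suc i)
  then have "(beta_map \<beta> ^^ Suc i) 1 = frac (of_int (x i) + R (Suc i))"
    using assms(2)[of i] by (simp add: beta_map_def[of \<beta> "R i"])
  also have "\<dots> = R (Suc i)"
    using assms(3)[of i] Suc by (simp add: frac_eq)
  finally show ?case .
qed (simp add: assms)

lemma beta_digit_eqI:
  assumes "\<beta> * (beta_map \<beta> ^^ i) 1 = of_int d + r" "0 \<le> r" "r < 1"
  shows "beta_digit \<beta> i = d"
  using assms by (simp add: beta_digit_def floor_eq_iff)

lemma over_upper_mechanical:
  "over b (upper_mechanical \<gamma> n) = upper_mechanical (\<gamma> + of_int (b - 1)) n"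
  unfolding upper_mechanical_add_int by (simp add: over_def)

lemma beta_expansion_eq_Infinite_iff:
  assumes "\<And>n. \<exists>i\<ge>n. x i \<noteq> 0"
  shows "beta_expansion \<beta> = Infinite x \<longleftrightarrow> beta_digit \<beta> = x"
  using assms by (auto simp: beta_expansion_def split: if_splits)

text \<open>The digit at m is the last nonzero one, so omitting trailing zeros cuts exactly after
  position m.\<close>

lemma beta_expansion_eq_Finite_iff:
  assumes "x m \<noteq> 0" and "\<And>i. i > m \<Longrightarrow> x i = 0"
  shows "beta_expansion \<beta> = Finite (map x [0..<Suc m]) \<longleftrightarrow> beta_digit \<beta> = x"
proof
  assume *: "beta_digit \<beta> = x"
  have "(LEAST n. \<forall>i\<ge>n. x i = 0) = Suc m"
    using assms by (intro Least_equality) (auto simp: Suc_le_eq intro: leI)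
  moreover have "\<exists>n. \<forall>i\<ge>n. x i = 0"
    using assms by (intro exI[of _ "Suc m"]) auto
  ultimately show "beta_expansion \<beta> = Finite (map x [0..<Suc m])"
    by (simp add: beta_expansion_def *)
next
  assume *: "beta_expansion \<beta> = Finite (map x [0..<Suc m])"
  define N where "N = (LEAST n. \<forall>i\<ge>n. beta_digit \<beta> i = 0)"
  have ex: "\<exists>n. \<forall>i\<ge>n. beta_digit \<beta> i = 0"
    and eq: "map (beta_digit \<beta>) [0..<N] = map x [0..<Suc m]"
    using * by (auto simp: beta_expansion_def N_def split: if_splits)
  have N: "N = Suc m"
    using arg_cong[OF eq, of length] by simp
  have zero: "\<forall>i\<ge>N. beta_digit \<beta> i = 0"
    unfolding N_def by (rule LeastI_ex[OF ex])
  show "beta_digit \<beta> = x"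
  proof
    fix i
    show "beta_digit \<beta> i = x i"
    proof (cases "i < Suc m")
      case True
      then show ?thesis
        using arg_cong[OF eq, of "\<lambda>xs. xs ! i"] N by (simp del: upt_Suc)
    next
      case False
      then show ?thesis
        using zero N assms(2)[of i] by simp
    qed
  qed
qed

lemma irrational_mult_nat_not_Ints:
  assumes "\<alpha> \<notin> \<rat>" "q > 0"
  shows "real q * \<alpha> \<notin> \<int>"
proof
  assume "real q * \<alpha> \<in> \<int>"
  then have "real q * \<alpha> / real q \<in> \<rat>"
    using Ints_subset_Rats by (intro Rats_divide) auto
  then show False
    using assms by simp
qed

text \<open>The digits always represent 1 in base \<beta>, which gives one direction. For the other,
  irrationality keeps \<alpha> i off the integers for i > 0, so all proper tails lie in [0, 1) and
  form the orbit of 1.\<close>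

lemma beta_expansion_characteristic_iff:
  assumes "\<alpha> > 0" "\<alpha> \<notin> \<rat>" "\<beta> > 1"
  shows "beta_expansion \<beta> = Infinite (upper_mechanical \<alpha>) \<longleftrightarrow> mechanical_series \<alpha> (1 / \<beta>) = 1"
proof -
  let ?t = "1 / \<beta>"
  have t: "0 < ?t" "?t < 1"
    using assms by auto
  have "beta_expansion \<beta> = Infinite (upper_mechanical \<alpha>) \<longleftrightarrow> beta_digit \<beta> = upper_mechanical \<alpha>"
    by (intro beta_expansion_eq_Infinite_iff upper_mechanical_not_eventually_0 assms)
  also have "\<dots> \<longleftrightarrow> mechanical_series \<alpha> ?t = 1"
  proof
    assume "beta_digit \<beta> = upper_mechanical \<alpha>"
    then show "mechanical_series \<alpha> ?t = 1"
      using beta_digit_sums[OF assms(3)] by (simp add: mechanical_tail_def sums_iff)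
  next
    assume 1: "mechanical_series \<alpha> ?t = 1"
    let ?R = "\<lambda>i. mechanical_tail \<alpha> i ?t"
    have rec: "\<beta> * ?R i = of_int (upper_mechanical \<alpha> i) + ?R (Suc i)" for i
      using mechanical_tail_rec[of \<alpha> ?t i] assms by simp
    have "\<alpha> * real (Suc i) \<notin> \<int>" for i
      using irrational_mult_nat_not_Ints[OF assms(2), of "Suc i"] by (simp add: mult.commute)
    then have R: "0 \<le> ?R (Suc i)" "?R (Suc i) < 1" for i
      using mechanical_tail_less_series[of \<alpha> ?t "Suc i"] mechanical_tail_nonneg[of \<alpha> ?t "Suc i"]
        assms t 1 by auto
    have "(beta_map \<beta> ^^ i) 1 = ?R i" for i
      using beta_orbit_eqI[where R = ?R and x = "upper_mechanical \<alpha>" and m = i and i = i] rec R 1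
      by simp
    then show "beta_digit \<beta> = upper_mechanical \<alpha>"
      using rec R by (intro ext beta_digit_eqI) auto
  qed
  finally show ?thesis .
qed

lemma mechanical_series_periodic:
  assumes "\<alpha> \<ge> 0" "0 \<le> t" "t < 1" and per: "\<And>i. upper_mechanical \<alpha> (i + q) = upper_mechanical \<alpha> i"
  shows "mechanical_series \<alpha> t =
    (\<Sum>i<q. of_int (upper_mechanical \<alpha> i) * t ^ Suc i) + t ^ q * mechanical_series \<alpha> t"
proof -
  let ?f = "\<lambda>n. of_int (upper_mechanical \<alpha> n) * t ^ Suc n :: real"
  have s: "summable ?f"
    using summable_upper_mechanical[OF assms(1-3), of 0] by simp
  have "suminf ?f = (\<Sum>n. ?f (n + q)) + (\<Sum>i<q. ?f i)"
    by (rule suminf_split_initial_segment[OF s])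
  also have "(\<Sum>n. ?f (n + q)) = (\<Sum>n. t ^ q * ?f n)"
    by (simp add: per power_add mult_ac)
  also have "\<dots> = t ^ q * suminf ?f"
    by (rule suminf_mult[OF s])
  finally show ?thesis
    by (simp add: mechanical_tail_def)
qed

text \<open>The mechanical word of slope \<alpha> has the period b z (b-1), whereas the expansion is
  b z b. When the series has value 1, so does its tail after one period; raising the last letter by
  1 compensates exactly for omitting that tail.\<close>

lemma beta_expansion_central_iff:
  assumes pq: "0 < p" "p < q" "coprime p q" and b: "b \<ge> 1" and "\<beta> > 1"
    and \<alpha>: "\<alpha> = real p / real q + of_int (b - 1)"
  shows "beta_expansion \<beta> = Finite (b # map (over b) (central_word p q) @ [b]) \<longleftrightarrow>
    mechanical_series \<alpha> (1 / \<beta>) = 1"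
proof -
  let ?t = "1 / \<beta>"
  define a where "a = upper_mechanical \<alpha>"
  obtain m where m: "q = Suc m"
    using pq by (cases q) auto
  have t: "0 < ?t" "?t < 1"
    using assms by auto
  have "\<alpha> > 0"
    using pq b unfolding \<alpha> by (intro add_pos_nonneg) auto
  have \<alpha>q: "\<alpha> * real q = of_int (int p + (b - 1) * int q)"
    using pq by (simp add: \<alpha> algebra_simps)
  have shift: "\<lceil>\<alpha> * real (i + q)\<rceil> = \<lceil>\<alpha> * real i\<rceil> + (int p + (b - 1) * int q)" for i
  proof -
    have "\<alpha> * real (i + q) = \<alpha> * real i + of_int (int p + (b - 1) * int q)"
      using \<alpha>q by (simp add: distrib_left)
    then show ?thesis
      by (simp only: ceiling_add_of_int)
  qed
  have per: "a (i + q) = a i" for i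
    using shift[of i] shift[of "i + 1"]
    unfolding a_def upper_mechanical_def by (simp add: add_ac)
  have "map a [0..<Suc m] = map (over b) (christoffel_word p q)"
    by (simp add: a_def christoffel_word_def over_upper_mechanical \<alpha> m)
  also have "\<dots> = b # map (over b) (central_word p q) @ [b - 1]"
    using christoffel_word_factor[OF pq(1,2)] by (simp add: over_def)
  finally have "map a [0..<m] @ [a m] = (b # map (over b) (central_word p q)) @ [b - 1]"
    by simp
  then have am: "a m = b - 1" and word: "map a [0..<m] = b # map (over b) (central_word p q)"
    unfolding append1_eq_conv by auto
  define d where "d i = (if i < m then a i else if i = m then b else 0)" for i
  have "b # map (over b) (central_word p q) @ [b] = map a [0..<m] @ [b]"
    using word by simp
  also have "\<dots> = map d [0..<Suc m]"
    by (auto simp: d_def)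
  finally have "beta_expansion \<beta> = Finite (b # map (over b) (central_word p q) @ [b]) \<longleftrightarrow>
      beta_expansion \<beta> = Finite (map d [0..<Suc m])"
    by (simp only:)
  also have "\<dots> \<longleftrightarrow> beta_digit \<beta> = d"
    by (rule beta_expansion_eq_Finite_iff) (use b in \<open>auto simp: d_def\<close>)
  also have "\<dots> \<longleftrightarrow> mechanical_series \<alpha> ?t = 1"
  proof
    assume d: "beta_digit \<beta> = d"
    have "(\<lambda>i. of_int (d i) * ?t ^ Suc i) sums (\<Sum>i<q. of_int (d i) * ?t ^ Suc i)"
      by (rule sums_finite) (auto simp: d_def m)
    then have "1 = (\<Sum>i<q. of_int (d i) * ?t ^ Suc i)"
      using beta_digit_sums[OF assms(5)] unfolding d by (rule sums_unique2[symmetric])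
    also have "\<dots> = (\<Sum>i<m. of_int (a i) * ?t ^ Suc i) + of_int b * ?t ^ q"
      by (simp add: m d_def)
    \<comment> \<open>Since \<open>a m = b - 1\<close>, the final digit b contributes one extra
      power t^q.\<close>
    also have "\<dots> = (\<Sum>i<q. of_int (a i) * ?t ^ Suc i) + ?t ^ q"
      by (simp add: m am algebra_simps diff_divide_distrib)
    finally have "mechanical_series \<alpha> ?t * (1 - ?t ^ q) = 1 - ?t ^ q"
      using mechanical_series_periodic[of \<alpha> ?t q] per t \<open>\<alpha> > 0\<close>
      by (simp add: a_def algebra_simps)
    moreover have "?t ^ q < 1"
      using t pq by (intro power_less_one_iff[THEN iffD2]) auto
    ultimately show "mechanical_series \<alpha> ?t = 1"
      by simp
  next
    assume 1: "mechanical_series \<alpha> ?t = 1"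
    let ?R = "\<lambda>i. mechanical_tail \<alpha> i ?t"
    have rec: "\<beta> * ?R i = of_int (a i) + ?R (Suc i)" for i
      using mechanical_tail_rec[of \<alpha> ?t i] assms(5) \<open>\<alpha> > 0\<close> by (simp add: a_def)
    \<comment> \<open>After a full period the tail is the whole series again. Its value 1 lies
      outside [0, 1), so from index q on the tails are no longer the orbit.\<close>
    have Rq: "?R q = 1"
    proof -
      have "?R q = ?R 0"
        using per by (simp add: mechanical_tail_def a_def add.commute)
      then show ?thesis
        using 1 by simp
    qed
    \<comment> \<open>By coprimality q divides p (i+1) only if it divides i+1, which is impossible
      for 0 < i+1 < q.\<close>
    have nint: "\<alpha> * real (Suc i) \<notin> \<int>" if "i < m" for i
    proof
      assume "\<alpha> * real (Suc i) \<in> \<int>"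
      then have "\<alpha> * real (Suc i) - of_int ((b - 1) * int (Suc i)) \<in> \<int>"
        by (intro Ints_diff Ints_of_int)
      also have "\<alpha> * real (Suc i) - of_int ((b - 1) * int (Suc i)) = real (p * Suc i) / real q"
        by (simp add: \<alpha> algebra_simps)
      finally obtain k where "real (p * Suc i) / real q = of_int k"
        by (auto elim: Ints_cases)
      then have "real_of_int (int (p * Suc i)) = of_int (int q * k)"
        using pq by (simp add: field_simps)
      then have "int (p * Suc i) = int q * k"
        by (simp only: of_int_eq_iff)
      then have "int q dvd int (p * Suc i)"
        by (rule dvdI)
      then have "q dvd p * Suc i"
        by (simp only: of_nat_dvd_iff)
      then have "q dvd Suc i"
        using coprime_dvd_mult_right_iff[of q p "Suc i"] pq(3) by (simp only: coprime_commute)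
      then show False
        using that m by (auto dest: dvd_imp_le)
    qed
    then have R: "0 \<le> ?R (Suc i)" "?R (Suc i) < 1" if "i < m" for i
      using mechanical_tail_less_series[of \<alpha> ?t "Suc i"] mechanical_tail_nonneg[of \<alpha> ?t "Suc i"]
        \<open>\<alpha> > 0\<close> t 1 that by auto
    have orb: "(beta_map \<beta> ^^ i) 1 = ?R i" if "i \<le> m" for i
      using beta_orbit_eqI[where R = ?R and x = a and m = m and i = i] rec R 1 that
      by simp
    \<comment> \<open>The tail 1 is absorbed into the digit: (b-1) + 1 = b + 0, and the orbit
      continues with 0.\<close>
    have bm: "\<beta> * (beta_map \<beta> ^^ m) 1 = of_int b + 0"
      using rec[of m] Rq orb[of m] am by (simp add: m)
    have "(beta_map \<beta> ^^ (Suc m + k)) 1 = 0" for k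
    proof (induction k)
      case 0
      show ?case
        using bm by (simp add: beta_map_def[of \<beta> "(beta_map \<beta> ^^ m) 1"])
    next
      case (Suc k)
      then show ?case
        by (simp add: beta_map_def[of \<beta> 0])
    qed
    then have orb0: "(beta_map \<beta> ^^ i) 1 = 0" if "i > m" for i
      using that by (metis Suc_leI le_add_diff_inverse)
    show "beta_digit \<beta> = d"
    proof
      fix i
      consider "i < m" | "i = m" | "i > m"
        by linarith
      then show "beta_digit \<beta> i = d i"
      proof cases
        case 1
        then show ?thesis
          using beta_digit_eqI[of \<beta> i "a i" "?R (Suc i)"] orb[of i] rec[of i] R[of i]
          by (simp add: d_def)
      next
        case 2
        then show ?thesis
          using beta_digit_eqI[OF bm] by (simp add: d_def)
      next
        case 3
        then show ?thesis
          using orb0[OF 3] by (simp add: d_def beta_digit_def)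
      qed
    qed
  qed
  finally show ?thesis .
qed

subsection \<open>The function Delta near a non-integral point\<close>

text \<open>Both clauses of \<open>Delta\<close> for non-integral arguments reduce to one equation,
  so no later argument has to separate rational from irrational slopes.\<close>

lemma Delta_eq_THE:
  assumes "\<alpha> > 0" "\<alpha> \<notin> \<int>"
  shows "Delta \<alpha> = (THE \<beta>. \<beta> > 1 \<and> mechanical_series \<alpha> (1 / \<beta>) = 1)"
proof -
  define b where "b = \<lceil>\<alpha>\<rceil>"
  define \<gamma> where "\<gamma> = \<alpha> - real_of_int b + 1"
  have b: "b \<ge> 1"
    using assms by (simp add: b_def le_ceiling_iff)
  have \<alpha>: "\<alpha> = \<gamma> + of_int (b - 1)"
    by (simp add: \<gamma>_def)
  have "real_of_int b \<noteq> \<alpha>"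
    using assms by (metis Ints_of_int)
  then have \<gamma>: "0 < \<gamma>" "\<gamma> < 1"
    unfolding \<gamma>_def b_def by linarith+
  show ?thesis
  proof (cases "\<alpha> \<in> \<rat>")
    case False
    have "case_nat b (\<lambda>n. over b (characteristic_word \<gamma> n)) = upper_mechanical \<alpha>"
    proof
      fix n
      show "case_nat b (\<lambda>n. over b (characteristic_word \<gamma> n)) n = upper_mechanical \<alpha> n"
        using upper_mechanical_0[OF \<gamma>] over_upper_mechanical[of b \<gamma> n]
        unfolding \<alpha>[symmetric] by (cases n) (auto simp: characteristic_word_def over_def)
    qed
    then have "Delta \<alpha> = (THE \<beta>. \<beta> > 1 \<and> beta_expansion \<beta> = Infinite (upper_mechanical \<alpha>))"
      using assms False by (simp add: Delta_def Let_def \<gamma>_def b_def)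
    also have "\<dots> = (THE \<beta>. \<beta> > 1 \<and> mechanical_series \<alpha> (1 / \<beta>) = 1)"
      by (simp add: beta_expansion_characteristic_iff[OF assms(1) False] cong: conj_cong)
    finally show ?thesis .
  next
    case True
    then have "\<gamma> \<in> \<rat>"
      by (simp add: \<gamma>_def)
    then obtain p q :: nat where pq: "q \<noteq> 0" "\<bar>\<gamma>\<bar> = real p / real q" "coprime p q"
      by (rule Rats_abs_nat_div_natE)
    then have pq': "\<gamma> = real p / real q"
      using \<gamma> by simp
    have "0 < p" "p < q"
      using \<gamma> pq(1) unfolding pq' by (auto simp: zero_less_divide_iff divide_less_eq)
    have iff: "beta_expansion \<beta> = Finite (b # map (over b) (central_word p' q') @ [b]) \<longleftrightarrow>
        mechanical_series \<alpha> (1 / \<beta>) = 1"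
      if "0 < p'" "p' < q'" "coprime p' q'" "\<gamma> = real p' / real q'" "\<beta> > 1" for p' q' \<beta>
      using beta_expansion_central_iff[OF that(1-3) b that(5)] \<alpha> that(4) by blast
    \<comment> \<open>The reduced fraction of \<gamma> supplies the witnesses; conversely every
      admissible pair leads to the same equation.\<close>
    have "(\<beta> > 1 \<and> (\<exists>p q. 0 < p \<and> p < q \<and> coprime p q \<and> \<gamma> = real p / real q \<and>
         beta_expansion \<beta> = Finite (b # map (over b) (central_word p q) @ [b]))) \<longleftrightarrow>
       (\<beta> > 1 \<and> mechanical_series \<alpha> (1 / \<beta>) = 1)" for \<beta>
      using iff iff[OF \<open>0 < p\<close> \<open>p < q\<close> pq(3) pq'] \<open>0 < p\<close> \<open>p < q\<close> pq(3) pq' by metis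
    then show ?thesis
      using assms True by (simp add: Delta_def Let_def \<gamma>_def b_def)
  qed
qed

text \<open>The intermediate value argument gives existence and injectivity in t gives uniqueness,
  so the \<open>THE\<close> denotes an actual solution.\<close>

lemma Delta_properties:
  assumes "\<alpha> > 0" "\<alpha> \<notin> \<int>"
  shows "1 + \<alpha> \<le> Delta \<alpha>" and "mechanical_series \<alpha> (1 / Delta \<alpha>) = 1"
proof -
  obtain t where t: "0 < t" "t \<le> 1 / (1 + \<alpha>)" "mechanical_series \<alpha> t = 1"
    using mechanical_series_eq_1_exists[OF assms(1)] .
  have ge: "1 + \<alpha> \<le> 1 / t" and "t < 1"
  proof -
    show "1 + \<alpha> \<le> 1 / t"
      using t assms by (simp add: field_simps)
    have "1 / (1 + \<alpha>) < 1"
      using assms by simp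
    then show "t < 1"
      using t by linarith
  qed
  have "(THE \<beta>. \<beta> > 1 \<and> mechanical_series \<alpha> (1 / \<beta>) = 1) = 1 / t"
  proof (rule the_equality)
    show "1 / t > 1 \<and> mechanical_series \<alpha> (1 / (1 / t)) = 1"
      using t \<open>t < 1\<close> by auto
    fix \<beta>
    assume \<beta>: "\<beta> > 1 \<and> mechanical_series \<alpha> (1 / \<beta>) = 1"
    then have "0 \<le> 1 / \<beta>" "1 / \<beta> < 1" "mechanical_series \<alpha> (1 / \<beta>) = mechanical_series \<alpha> t"
      using t by auto
    then have "1 / \<beta> = t"
      using mechanical_series_inj[of \<alpha> "1 / \<beta>" t] t(1) \<open>t < 1\<close> assms(1) by linarith
    then show "\<beta> = 1 / t"
      by auto
  qed
  then have "Delta \<alpha> = 1 / t"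
    using Delta_eq_THE[OF assms] by simp
  then show "1 + \<alpha> \<le> Delta \<alpha>" "mechanical_series \<alpha> (1 / Delta \<alpha>) = 1"
    using t ge by auto
qed

text \<open>Reduces the variation of \<open>Delta\<close> to that of the series in the slope, at the
  fixed argument 1 / Delta \<alpha>'. The constant depends only on the interval.\<close>

lemma Delta_difference_bounds:
  assumes "0 < u" "\<alpha> \<in> {u<..<v}" "\<alpha>' \<in> {u<..<v}" "\<alpha> \<notin> \<int>" "\<alpha>' \<notin> \<int>"
  defines "K \<equiv> (v + 1) / (1 - 1 / (1 + u))\<^sup>2"
    and "D \<equiv> \<bar>mechanical_series \<alpha> (1 / Delta \<alpha>') - mechanical_series \<alpha>' (1 / Delta \<alpha>')\<bar>"
  shows "\<bar>Delta \<alpha> - Delta \<alpha>'\<bar> \<le> K\<^sup>2 * D" and "D \<le> K * \<bar>Delta \<alpha> - Delta \<alpha>'\<bar>"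
proof -
  \<comment> \<open>This bounds 1 / Delta x from above, because Delta x is at least 1 + x > 1 +
    u.\<close>
  define r where "r = 1 / (1 + u)"
  have r: "0 < r" "r < 1"
    using assms by (auto simp: r_def)
  have K: "K = (v + 1) / (1 - r)\<^sup>2" "K > 0"
    using assms r by (auto simp: K_def r_def)
  have t: "0 < 1 / Delta x" "1 / Delta x \<le> r" "mechanical_series x (1 / Delta x) = 1"
      "1 \<le> Delta x" "Delta x \<le> K"
    if x: "x \<in> {u<..<v}" "x \<notin> \<int>" for x
  proof -
    have x0: "x > 0"
      using x assms by auto
    note D = Delta_properties[OF x0 x(2)]
    show ge1: "1 \<le> Delta x"
      using D x0 by simp
    show le: "1 / Delta x \<le> r"
      using D x assms unfolding r_def by (intro divide_left_mono) auto
    show "mechanical_series x (1 / Delta x) = 1"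
      by fact
    \<comment> \<open>The series is 0 at 0 and 1 at 1 / Delta x, so the upper Lipschitz bound
      applies between these arguments.\<close>
    have "1 \<le> K * (1 / Delta x)"
      using mechanical_series_diff_le[of x v 0 "1 / Delta x" r] D x x0 le r ge1
      unfolding K(1) by simp
    then show "Delta x \<le> K"
      using ge1 by (simp add: field_simps)
    show "0 < 1 / Delta x"
      using ge1 by simp
  qed
  define s t where "s = 1 / Delta \<alpha>'" and "t = 1 / Delta \<alpha>"
  note t\<alpha> = t[OF assms(2,4)] and t\<alpha>' = t[OF assms(3,5)]
  have \<alpha>: "\<alpha> > 0" "\<alpha> \<le> v"
    using assms by auto
  \<comment> \<open>Each series equals 1 at its own root, so a change of slope at s is traded for a
    change of argument in the series of \<alpha>.\<close>
  have D: "D = \<bar>mechanical_series \<alpha> s - mechanical_series \<alpha> t\<bar>"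
    using t\<alpha> t\<alpha>' by (simp add: D_def s_def t_def)
  have st: "0 < s" "s \<le> r" "0 < t" "t \<le> r"
    using t\<alpha> t\<alpha>' by (auto simp: s_def t_def)
  have bounds: "\<bar>s - t\<bar> \<le> D \<and> D \<le> K * \<bar>s - t\<bar>"
  proof (cases "s \<le> t")
    case True
    then show ?thesis
      using mechanical_series_diff_ge[of \<alpha> s t] mechanical_series_diff_le[of \<alpha> v s t r] st r \<alpha>
      unfolding D K(1) by (simp add: abs_if)
  next
    case False
    then show ?thesis
      using mechanical_series_diff_ge[of \<alpha> t s] mechanical_series_diff_le[of \<alpha> v t s r] st r \<alpha>
      unfolding D K(1) by (simp add: abs_if)
  qed
  have "Delta \<alpha> - Delta \<alpha>' = Delta \<alpha> * Delta \<alpha>' * (s - t)"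
    using t\<alpha>(4) t\<alpha>'(4) by (simp add: s_def t_def field_simps)
  then have eq: "\<bar>Delta \<alpha> - Delta \<alpha>'\<bar> = Delta \<alpha> * Delta \<alpha>' * \<bar>s - t\<bar>"
    using t\<alpha>(4) t\<alpha>'(4) by (simp add: abs_mult)
  also have "\<dots> \<le> (K * K) * D"
    using t\<alpha>(4,5) t\<alpha>'(4,5) bounds K(2) by (intro mult_mono) auto
  finally show "\<bar>Delta \<alpha> - Delta \<alpha>'\<bar> \<le> K\<^sup>2 * D"
    by (simp add: power2_eq_square)
  have "1 * 1 * \<bar>s - t\<bar> \<le> \<bar>Delta \<alpha> - Delta \<alpha>'\<bar>"
    unfolding eq using t\<alpha>(4) t\<alpha>'(4) by (intro mult_mono) auto
  then have "K * \<bar>s - t\<bar> \<le> K * \<bar>Delta \<alpha> - Delta \<alpha>'\<bar>"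
    using K(2) by simp
  then show "D \<le> K * \<bar>Delta \<alpha> - Delta \<alpha>'\<bar>"
    using bounds by linarith
qed

text \<open>In the ceiling form all terms of the difference are nonnegative, and the q-th is at
  least t^q because distinct integers differ by at least 1.\<close>

lemma mechanical_series_diff_ge_term:
  assumes "0 \<le> \<alpha>'" "\<alpha>' \<le> \<alpha>" "0 \<le> t" "t < 1" "\<lceil>\<alpha>' * real q\<rceil> < \<lceil>\<alpha> * real q\<rceil>"
  shows "(1 - t) * t ^ q \<le> mechanical_series \<alpha> t - mechanical_series \<alpha>' t"
proof -
  let ?f = "\<lambda>\<alpha> n. real_of_int \<lceil>\<alpha> * real n\<rceil> * t ^ n"
  have "1 * t ^ q \<le> (of_int \<lceil>\<alpha> * real q\<rceil> - of_int \<lceil>\<alpha>' * real q\<rceil>) * t ^ q"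
    using assms by (intro mult_right_mono) auto
  also have "\<dots> = ?f \<alpha> q - ?f \<alpha>' q"
    by (simp add: algebra_simps)
  also have "\<dots> \<le> suminf (?f \<alpha>) - suminf (?f \<alpha>')"
    using assms summable_ceiling_mult_power[of \<alpha> t 0] summable_ceiling_mult_power[of \<alpha>' t 0]
    by (intro suminf_diff_ge_term) (auto intro!: mult_right_mono ceiling_mono)
  finally have "(1 - t) * t ^ q \<le> (1 - t) * (suminf (?f \<alpha>) - suminf (?f \<alpha>'))"
    using assms by (intro mult_left_mono) auto
  then show ?thesis
    using assms by (simp add: mechanical_series_eq_ceiling_sum right_diff_distrib)
qed

subsection \<open>Diophantine approximation\<close>

lemma dist_int_le: "dist_int x \<le> \<bar>x - of_int m\<bar>"
  unfolding dist_int_round by (rule round_diff_minimal)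

lemma dist_int_nonneg [simp]: "0 \<le> dist_int x"
  by (simp add: dist_int_round)

lemma dist_int_pos:
  assumes "\<alpha> \<notin> \<rat>" "q > 0"
  shows "0 < dist_int (real q * \<alpha>)"
proof -
  have "real q * \<alpha> \<noteq> of_int (round (real q * \<alpha>))"
    using irrational_mult_nat_not_Ints[OF assms] by (metis Ints_of_int)
  then show ?thesis
    by (simp add: dist_int_round)
qed

lemma dist_int_le_if_ceiling_neq:
  assumes "\<lceil>\<alpha> * real n\<rceil> \<noteq> \<lceil>\<alpha>' * real n\<rceil>"
  shows "dist_int (real n * \<alpha>') \<le> real n * \<bar>\<alpha> - \<alpha>'\<bar>"
proof -
  \<comment> \<open>The smaller ceiling lies between n \<alpha> and n \<alpha>', so its distance to
    either is at most their difference.\<close>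
  define m where "m = min \<lceil>\<alpha> * real n\<rceil> \<lceil>\<alpha>' * real n\<rceil>"
  have "\<bar>real n * \<alpha>' - of_int m\<bar> \<le> \<bar>\<alpha> * real n - \<alpha>' * real n\<bar>"
    using assms unfolding m_def mult.commute[of "real n"] min_def by (auto split: if_splits) linarith+
  also have "\<dots> = real n * \<bar>\<alpha> - \<alpha>'\<bar>"
    by (simp add: abs_mult mult.commute flip: left_diff_distrib)
  finally show ?thesis
    using dist_int_le[of "real n * \<alpha>'" m] by linarith
qed

lemma power_powr_swap:
  fixes x a :: real
  assumes "x \<ge> 0"
  shows "(x ^ n) powr a = (x powr a) ^ n"
  using assms by (induction n) (auto simp: powr_mult)

text \<open>A nonzero n-th term forces 1 \<le> l^n \<bar>\<alpha> - \<alpha>'\<bar> / c. The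
  \<zeta>-th power of the right-hand side, inserted as a factor, brings out \<bar>\<alpha> -
  \<alpha>'\<bar>^\<zeta> and turns the ratio t into l^\<zeta> t, which is still below 1.\<close>

lemma mechanical_series_diff_le_powr:
  assumes "0 \<le> \<alpha>" "0 \<le> \<alpha>'" "\<bar>\<alpha> - \<alpha>'\<bar> \<le> A" "0 < t" "t < 1" "0 < c" "0 < \<zeta>" "1 < l"
    and approx: "\<And>q::nat. q > 0 \<Longrightarrow> c * real q \<le> l ^ q * dist_int (real q * \<alpha>')"
    and s: "l powr \<zeta> * t < 1"
  shows "\<bar>mechanical_series \<alpha> t - mechanical_series \<alpha>' t\<bar> \<le>
    (A + 1) / (1 - l powr \<zeta> * t)\<^sup>2 * (\<bar>\<alpha> - \<alpha>'\<bar> / c) powr \<zeta>"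
proof -
  define e where "e = (\<bar>\<alpha> - \<alpha>'\<bar> / c) powr \<zeta>"
  define s where "s = l powr \<zeta> * t"
  have s01: "0 < s" "s < 1"
    using assms by (auto simp: s_def)
  let ?f = "\<lambda>n. (real_of_int \<lceil>\<alpha> * real n\<rceil> - of_int \<lceil>\<alpha>' * real n\<rceil>) * t ^ n"
  let ?g = "\<lambda>n. (A + 1) * e * (real (Suc n) * s ^ n)"
  have g: "?g sums ((A + 1) * e * (1 / (1 - s)\<^sup>2))"
    using geometric_deriv_sums[of s] s01 by (intro sums_mult) auto
  have "A \<ge> 0" "e \<ge> 0"
    using assms by (auto simp: e_def)
  have bound: "norm (?f n) \<le> ?g n" for n
  proof (cases "\<lceil>\<alpha> * real n\<rceil> = \<lceil>\<alpha>' * real n\<rceil>")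
    case True
    then show ?thesis
      using \<open>A \<ge> 0\<close> \<open>e \<ge> 0\<close> s01 by simp
  next
    case False
    then have "n > 0"
      by (intro gr0I) auto
    have "c * real n \<le> l ^ n * (real n * \<bar>\<alpha> - \<alpha>'\<bar>)"
      using approx[OF \<open>n > 0\<close>] dist_int_le_if_ceiling_neq[OF False] \<open>1 < l\<close>
      by (elim order_trans) (intro mult_left_mono, auto)
    then have "c \<le> l ^ n * \<bar>\<alpha> - \<alpha>'\<bar>"
      using \<open>n > 0\<close> by (simp add: mult.left_commute)
    then have "1 \<le> l ^ n * (\<bar>\<alpha> - \<alpha>'\<bar> / c)"
      using \<open>c > 0\<close> by (simp add: field_simps)
    then have "1 powr \<zeta> \<le> (l ^ n * (\<bar>\<alpha> - \<alpha>'\<bar> / c)) powr \<zeta>"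
      using \<open>\<zeta> > 0\<close> by (intro powr_mono2) auto
    also have "\<dots> = (l powr \<zeta>) ^ n * e"
      unfolding e_def using assms
      by (subst powr_mult) (auto simp: power_powr_swap)
    finally have "t ^ n * 1 \<le> t ^ n * ((l powr \<zeta>) ^ n * e)"
      using assms by (intro mult_left_mono) auto
    also have "\<dots> = e * s ^ n"
      by (simp add: s_def power_mult_distrib mult_ac)
    finally have tn: "t ^ n \<le> e * s ^ n"
      by simp
    have "\<bar>\<alpha> * real n - \<alpha>' * real n\<bar> = \<bar>\<alpha> - \<alpha>'\<bar> * real n"
      by (simp add: abs_mult flip: left_diff_distrib)
    also have "\<dots> \<le> A * real n"
      using assms by (intro mult_right_mono) auto
    finally have "\<bar>real_of_int \<lceil>\<alpha> * real n\<rceil> - of_int \<lceil>\<alpha>' * real n\<rceil>\<bar> \<le> A * real n + 1"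
      by linarith
    also have "\<dots> \<le> (A + 1) * real (Suc n)"
      using \<open>A \<ge> 0\<close> by (simp add: algebra_simps)
    finally have "\<bar>real_of_int \<lceil>\<alpha> * real n\<rceil> - of_int \<lceil>\<alpha>' * real n\<rceil>\<bar> * t ^ n \<le>
        ((A + 1) * real (Suc n)) * (e * s ^ n)"
      using tn assms by (intro mult_mono) auto
    then show ?thesis
      using assms by (simp add: abs_mult mult_ac)
  qed
  have "(\<Sum>n. ?f n) = (\<Sum>n. of_int \<lceil>\<alpha> * real n\<rceil> * t ^ n) - (\<Sum>n. of_int \<lceil>\<alpha>' * real n\<rceil> * t ^ n)"
    using suminf_diff[OF summable_ceiling_mult_power[of \<alpha> t 0] summable_ceiling_mult_power[of \<alpha>' t 0]]
      assms by (simp add: left_diff_distrib)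
  then have "\<bar>mechanical_series \<alpha> t - mechanical_series \<alpha>' t\<bar> = (1 - t) * norm (suminf ?f)"
    using assms by (simp add: mechanical_series_eq_ceiling_sum abs_mult flip: right_diff_distrib)
  also have "\<dots> \<le> 1 * norm (suminf ?f)"
    using assms by (intro mult_right_mono) auto
  also have "\<dots> \<le> suminf ?g"
    using g bound by (simp only: mult_1) (intro norm_suminf_le, auto simp: sums_iff)
  also have "\<dots> = (A + 1) / (1 - l powr \<zeta> * t)\<^sup>2 * e"
    using g by (simp add: sums_iff s_def)
  finally show ?thesis
    by (simp add: e_def)
qed

section \<open>Lower limits and the irrationality base\<close>

lemma liminf_nonzero_iff:
  fixes f :: "nat \<Rightarrow> real"
  assumes "\<And>n. f n \<ge> 0"
  shows "liminf (\<lambda>n. ereal (f n)) \<noteq> 0 \<longleftrightarrow> (\<exists>e>0. \<forall>\<^sub>F n in sequentially. e \<le> f n)"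
proof
  assume "liminf (\<lambda>n. ereal (f n)) \<noteq> 0"
  moreover have "0 \<le> liminf (\<lambda>n. ereal (f n))"
    using assms by (intro Liminf_bounded) auto
  ultimately have "0 < liminf (\<lambda>n. ereal (f n))"
    by simp
  then obtain e where e: "0 < ereal e" "ereal e < liminf (\<lambda>n. ereal (f n))"
    using ereal_dense2 by blast
  then have "\<forall>\<^sub>F n in sequentially. ereal e < ereal (f n)"
    by (intro less_LiminfD)
  then show "\<exists>e>0. \<forall>\<^sub>F n in sequentially. e \<le> f n"
    using e by (intro exI[of _ e]) (auto elim: eventually_mono)
next
  assume "\<exists>e>0. \<forall>\<^sub>F n in sequentially. e \<le> f n"
  then obtain e where e: "e > 0" "\<forall>\<^sub>F n in sequentially. e \<le> f n"
    by blast
  then have "ereal e \<le> liminf (\<lambda>n. ereal (f n))"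
    by (intro Liminf_bounded) auto
  then show "liminf (\<lambda>n. ereal (f n)) \<noteq> 0"
    using e by auto
qed

text \<open>Only finitely many positive values precede the range of the eventual bound, so a minimum
  serves as c.\<close>

lemma eventually_ge_pos_imp_uniform:
  fixes f :: "nat \<Rightarrow> real"
  assumes "\<forall>\<^sub>F n in sequentially. e \<le> f n" "e > 0" "\<And>n. n > 0 \<Longrightarrow> f n > 0"
  obtains c where "c > 0" "\<And>n. n > 0 \<Longrightarrow> c \<le> f n"
proof -
  obtain N where N: "\<And>n. n \<ge> N \<Longrightarrow> e \<le> f n"
    using assms(1) by (auto simp: eventually_sequentially)
  define c where "c = Min (insert e (f ` {0<..N}))"
  have "c > 0"
    using assms unfolding c_def by (subst Min_gr_iff) auto
  moreover have "c \<le> f n" if "n > 0" for n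
  proof (cases "n \<le> N")
    case True
    then show ?thesis
      using that unfolding c_def by (intro Min_le) auto
  next
    case False
    have "c \<le> e"
      unfolding c_def by (intro Min_le) auto
    then show ?thesis
      using N[of n] False by simp
  qed
  ultimately show ?thesis
    using that by blast
qed

text \<open>Above the supremum the lower limit cannot vanish, which bounds the terms below
  eventually; irrationality makes the remaining terms with q > 0 positive.\<close>

lemma approximation_bound_of_irrationality_base:
  assumes "\<alpha> \<notin> \<rat>" "irrationality_base \<alpha> < ereal l" "1 < l"
  obtains c where "c > 0" "\<And>q::nat. q > 0 \<Longrightarrow> c * real q \<le> l ^ q * dist_int (real q * \<alpha>)"
proof -
  let ?f = "\<lambda>q::nat. l ^ q / real q * dist_int (real q * \<alpha>)"
  have "liminf (\<lambda>q. ereal (?f q)) \<noteq> 0"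
  proof
    assume "liminf (\<lambda>q. ereal (?f q)) = 0"
    then have "ereal l \<le> irrationality_base \<alpha>"
      unfolding irrationality_base_def by (intro SUP_upper) auto
    then show False
      using assms by simp
  qed
  then obtain e where e: "e > 0" "\<forall>\<^sub>F q in sequentially. e \<le> ?f q"
    using liminf_nonzero_iff[of ?f] assms by auto
  have "?f q > 0" if "q > 0" for q
    using dist_int_pos[OF assms(1) that] assms that by (intro mult_pos_pos divide_pos_pos) auto
  then obtain c where c: "c > 0" "\<And>q. q > 0 \<Longrightarrow> c \<le> ?f q"
    using eventually_ge_pos_imp_uniform[OF e(2,1)] by blast
  show ?thesis
    using c by (intro that[of c]) (auto simp: field_simps)
qed

lemma noninteger_neighbourhood:
  fixes \<alpha> :: real
  assumes "\<alpha> > 0" "\<alpha> \<notin> \<int>"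
  obtains u v where "0 < u" "u < \<alpha>" "\<alpha> < v" "\<And>x. x \<in> {u<..<v} \<Longrightarrow> x \<notin> \<int>"
proof -
  have "of_int \<lfloor>\<alpha>\<rfloor> \<noteq> \<alpha>"
    using assms by (metis Ints_of_int)
  then have fl: "of_int \<lfloor>\<alpha>\<rfloor> < \<alpha>"
    using of_int_floor_le[of \<alpha>] by linarith
  \<comment> \<open>The midpoint, unlike the floor itself, stays positive when the floor is
    0.\<close>
  define u where "u = (of_int \<lfloor>\<alpha>\<rfloor> + \<alpha>) / 2"
  have "0 \<le> \<lfloor>\<alpha>\<rfloor>"
    using assms by simp
  show ?thesis
  proof (rule that)
    show "0 < u" "u < \<alpha>"
      using fl \<open>0 \<le> \<lfloor>\<alpha>\<rfloor>\<close> assms by (auto simp: u_def intro!: add_nonneg_pos)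
    show "\<alpha> < of_int \<lfloor>\<alpha>\<rfloor> + 1"
      by linarith
    fix x
    assume x: "x \<in> {u<..<of_int \<lfloor>\<alpha>\<rfloor> + 1}"
    show "x \<notin> \<int>"
    proof
      assume "x \<in> \<int>"
      then obtain k where k: "x = of_int k"
        by (auto elim: Ints_cases)
      have "of_int \<lfloor>\<alpha>\<rfloor> < x"
        using x fl by (simp add: u_def)
      then have "\<lfloor>\<alpha>\<rfloor> < k"
        by (simp add: k)
      moreover have "k < \<lfloor>\<alpha>\<rfloor> + 1"
        using x unfolding k by (simp flip: of_int_less_iff[where 'a = real])
      ultimately show False
        by simp
    qed
  qed
qed

subsection \<open>Order of the Lipschitz condition\<close>

definition hoelder_exponents :: "(real \<Rightarrow> real) \<Rightarrow> real \<Rightarrow> real set" where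
  "hoelder_exponents f x\<^sub>0 = {\<zeta>. \<exists>C u v. u < x\<^sub>0 \<and> x\<^sub>0 < v \<and>
     (\<forall>x\<in>{u<..<v}. \<bar>f x - f x\<^sub>0\<bar> \<le> C * \<bar>x - x\<^sub>0\<bar> powr \<zeta>)}"

lemma lipschitz_condition_at_iff:
  "lipschitz_condition_at \<eta> f x\<^sub>0 \<longleftrightarrow> \<eta> = (SUP \<zeta>\<in>hoelder_exponents f x\<^sub>0. ereal \<zeta>)"
  by (simp add: lipschitz_condition_at_def hoelder_exponents_def)

text \<open>A number l strictly between the irrationality base and Delta \<alpha>^(1/\<zeta>) serves
  twice: it gives a lower bound on the approximation quality, and l^\<zeta> / Delta \<alpha> < 1
  makes the comparison series converge.\<close>

lemma hoelder_exponent_Delta: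
  assumes "\<alpha> > 0" "\<alpha> \<notin> \<rat>" "\<zeta> > 0" "irrationality_base \<alpha> < ereal (Delta \<alpha> powr (1 / \<zeta>))"
  shows "\<zeta> \<in> hoelder_exponents Delta \<alpha>"
proof -
  have \<alpha>: "\<alpha> \<notin> \<int>"
    using assms Ints_subset_Rats by auto
  define t where "t = 1 / Delta \<alpha>"
  have Delta1: "Delta \<alpha> > 1"
    using Delta_properties(1)[OF assms(1) \<alpha>] assms by simp
  have "1 < Delta \<alpha> powr (1 / \<zeta>)"
    using Delta1 assms by (intro gr_one_powr) auto
  \<comment> \<open>The maximum ensures l > 1, which the approximation bound requires.\<close>
  then have "max 1 (irrationality_base \<alpha>) < ereal (Delta \<alpha> powr (1 / \<zeta>))"
    using assms by simp
  then obtain l where "max 1 (irrationality_base \<alpha>) < ereal l" "ereal l < ereal (Delta \<alpha> powr (1 / \<zeta>))"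
    using ereal_dense2 by blast
  then have l: "1 < l" "irrationality_base \<alpha> < ereal l" "l < Delta \<alpha> powr (1 / \<zeta>)"
    by auto
  obtain c where c: "c > 0" "\<And>q::nat. q > 0 \<Longrightarrow> c * real q \<le> l ^ q * dist_int (real q * \<alpha>)"
    using approximation_bound_of_irrationality_base[OF assms(2) l(2,1)] by blast
  have "l powr \<zeta> < (Delta \<alpha> powr (1 / \<zeta>)) powr \<zeta>"
    using l assms by (intro powr_less_mono2) auto
  then have "l powr \<zeta> < Delta \<alpha>"
    using assms Delta1 by (simp add: powr_powr)
  then have lt: "l powr \<zeta> * t < 1"
    using Delta1 by (simp add: t_def)
  obtain u v where uv: "0 < u" "u < \<alpha>" "\<alpha> < v" "\<And>x. x \<in> {u<..<v} \<Longrightarrow> x \<notin> \<int>"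
    using noninteger_neighbourhood[OF assms(1) \<alpha>] by blast
  define K where "K = (v + 1) / (1 - 1 / (1 + u))\<^sup>2"
  define M where "M = (v + 1) / (1 - l powr \<zeta> * t)\<^sup>2"
  have "\<bar>Delta x - Delta \<alpha>\<bar> \<le> (K\<^sup>2 * M * (1 / c) powr \<zeta>) * \<bar>x - \<alpha>\<bar> powr \<zeta>" if x: "x \<in> {u<..<v}" for x
  proof -
    have "\<bar>Delta x - Delta \<alpha>\<bar> \<le> K\<^sup>2 * \<bar>mechanical_series x t - mechanical_series \<alpha> t\<bar>"
      unfolding K_def t_def by (rule Delta_difference_bounds) (use uv x \<alpha> in auto)
    also have "\<dots> \<le> K\<^sup>2 * (M * (\<bar>x - \<alpha>\<bar> / c) powr \<zeta>)"
      unfolding M_def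
      using uv x c l lt assms Delta1
      by (intro mult_left_mono mechanical_series_diff_le_powr) (auto simp: t_def)
    also have "(\<bar>x - \<alpha>\<bar> / c) powr \<zeta> = (1 / c) powr \<zeta> * \<bar>x - \<alpha>\<bar> powr \<zeta>"
      using c by (simp add: powr_divide)
    finally show ?thesis
      by (simp add: mult_ac)
  qed
  then show ?thesis
    using uv(2,3) unfolding hoelder_exponents_def mem_Collect_eq by (intro exI conjI ballI)
qed

text \<open>For infinitely many q, some point at distance l^(-q) from \<alpha> has another q-th
  ceiling. There \<open>Delta\<close> changes by at least a constant times Delta \<alpha>^(-q), but
  by at most a constant times l^(-q \<zeta>).\<close>

lemma hoelder_exponent_Delta_bound:
  assumes "\<alpha> > 0" "\<alpha> \<notin> \<rat>" "\<zeta> > 0" "\<zeta> \<in> hoelder_exponents Delta \<alpha>" "1 < l"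
    and lim: "liminf (\<lambda>q::nat. ereal (l ^ q / real q * dist_int (real q * \<alpha>))) = 0"
  shows "l powr \<zeta> \<le> Delta \<alpha>"
proof (rule ccontr)
  assume "\<not> l powr \<zeta> \<le> Delta \<alpha>"
  then have gt: "Delta \<alpha> < l powr \<zeta>"
    by simp
  have \<alpha>: "\<alpha> \<notin> \<int>"
    using assms Ints_subset_Rats by auto
  define t where "t = 1 / Delta \<alpha>"
  have Delta1: "Delta \<alpha> > 1"
    using Delta_properties(1)[OF assms(1) \<alpha>] assms by simp
  then have t: "0 < t" "t < 1"
    by (auto simp: t_def)
  obtain u v where uv: "0 < u" "u < \<alpha>" "\<alpha> < v" "\<And>x. x \<in> {u<..<v} \<Longrightarrow> x \<notin> \<int>"
    using noninteger_neighbourhood[OF assms(1) \<alpha>] by blast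
  obtain C u' v' where C: "u' < \<alpha>" "\<alpha> < v'"
    "\<And>x. x \<in> {u'<..<v'} \<Longrightarrow> \<bar>Delta x - Delta \<alpha>\<bar> \<le> C * \<bar>x - \<alpha>\<bar> powr \<zeta>"
    using assms(4) unfolding hoelder_exponents_def by blast
  define K where "K = (v + 1) / (1 - 1 / (1 + u))\<^sup>2"
  define \<delta> where "\<delta> = min (min (\<alpha> - u) (v - \<alpha>)) (min (\<alpha> - u') (v' - \<alpha>))"
  have "\<delta> > 0"
    using uv C by (simp add: \<delta>_def)
  \<comment> \<open>B^q is the ratio of t^q to the \<zeta>-th power of l^(-q); its growth yields the
    contradiction.\<close>
  define B where "B = l powr \<zeta> * t"
  have "B > 1"
    using gt Delta1 by (simp add: B_def t_def)
  have "(\<lambda>q. (1 / l) ^ q) \<longlonglongrightarrow> 0"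
    using assms by (intro LIMSEQ_power_zero) auto
  then have ev1: "\<forall>\<^sub>F q in sequentially. (1 / l) ^ q < \<delta>"
    using \<open>\<delta> > 0\<close> by (rule order_tendstoD)
  have "filterlim (\<lambda>q. B ^ q) at_top sequentially"
    using \<open>B > 1\<close> by real_asymp
  then have ev2: "\<forall>\<^sub>F q in sequentially. K * C / (1 - t) < B ^ q"
    by (simp add: filterlim_at_top_dense)
  let ?f = "\<lambda>q::nat. l ^ q / real q * dist_int (real q * \<alpha>)"
  \<comment> \<open>With lower limit 0, not even 1 is an eventual lower bound, so infinitely many q
    remain after all conditions on large q are imposed.\<close>
  have "\<not> (\<forall>\<^sub>F q in sequentially. 1 \<le> ?f q)"
    using lim liminf_nonzero_iff[of ?f] assms(5) zero_less_one by auto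
  then have "\<exists>\<^sub>F q in sequentially. \<not> 1 \<le> ?f q"
    by (simp add: not_eventually)
  moreover have "\<forall>\<^sub>F q in sequentially. (1 / l) ^ q < \<delta> \<and> K * C / (1 - t) < B ^ q \<and> q > 0"
    by (intro eventually_conj ev1 ev2 eventually_gt_at_top)
  ultimately have "\<exists>\<^sub>F q in sequentially. \<not> 1 \<le> ?f q \<and>
      (1 / l) ^ q < \<delta> \<and> K * C / (1 - t) < B ^ q \<and> q > 0"
    by (rule frequently_eventually_frequently)
  then obtain q where q: "?f q < 1" "(1 / l) ^ q < \<delta>" "K * C / (1 - t) < B ^ q" "q > 0"
    unfolding not_le by (blast dest: frequently_ex)
  \<comment> \<open>Since \<open>?f q < 1\<close>, this exceeds the distance from \<alpha> to m / q,
    where m is the integer nearest to q \<alpha>. Moving \<alpha> by \<epsilon> towards m / q thus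
    crosses it and changes the q-th ceiling.\<close>
  define \<epsilon> where "\<epsilon> = (1 / l) ^ q"
  define m where "m = round (real q * \<alpha>)"
  have \<epsilon>: "0 < \<epsilon>" "\<epsilon> < \<delta>"
    using q assms by (auto simp: \<epsilon>_def)
  have "dist_int (real q * \<alpha>) < \<epsilon> * real q"
    using q assms by (simp add: \<epsilon>_def field_simps)
  then have m: "\<bar>real q * \<alpha> - of_int m\<bar> < \<epsilon> * real q"
    by (simp add: dist_int_round m_def)
  have "real q * \<alpha> \<noteq> of_int m"
    using irrational_mult_nat_not_Ints[OF assms(2) q(4)] Ints_of_int[of m] by metis
  then consider "real q * \<alpha> < of_int m" | "of_int m < real q * \<alpha>"
    by linarith
  then obtain x where x: "\<bar>x - \<alpha>\<bar> = \<epsilon>"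
    and ge: "(1 - t) * t ^ q \<le> \<bar>mechanical_series x t - mechanical_series \<alpha> t\<bar>"
  proof cases
    case 1
    then have "real q * \<alpha> \<le> of_int m" "of_int m < (\<alpha> + \<epsilon>) * real q"
      using m by (auto simp: algebra_simps)
    then have "\<lceil>\<alpha> * real q\<rceil> < \<lceil>(\<alpha> + \<epsilon>) * real q\<rceil>"
      by (metis ceiling_le less_ceiling_iff mult.commute order_le_less_trans)
    then have "(1 - t) * t ^ q \<le> mechanical_series (\<alpha> + \<epsilon>) t - mechanical_series \<alpha> t"
      using assms t \<epsilon> by (intro mechanical_series_diff_ge_term) auto
    then show thesis
      using \<epsilon> by (intro that[of "\<alpha> + \<epsilon>"]) auto
  next
    case 2
    then have "(\<alpha> - \<epsilon>) * real q \<le> of_int m" "of_int m < \<alpha> * real q"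
      using m by (auto simp: algebra_simps)
    then have "\<lceil>(\<alpha> - \<epsilon>) * real q\<rceil> < \<lceil>\<alpha> * real q\<rceil>"
      by (metis ceiling_le less_ceiling_iff order_le_less_trans)
    moreover have "0 \<le> \<alpha> - \<epsilon>"
      using \<epsilon> uv by (auto simp: \<delta>_def)
    ultimately have "(1 - t) * t ^ q \<le> mechanical_series \<alpha> t - mechanical_series (\<alpha> - \<epsilon>) t"
      using assms t \<epsilon> by (intro mechanical_series_diff_ge_term) auto
    then show thesis
      using \<epsilon> by (intro that[of "\<alpha> - \<epsilon>"]) auto
  qed
  have \<delta>_le: "\<delta> \<le> \<alpha> - u" "\<delta> \<le> v - \<alpha>" "\<delta> \<le> \<alpha> - u'" "\<delta> \<le> v' - \<alpha>"
    by (simp_all add: \<delta>_def)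
  have x_in: "x \<in> {u<..<v}" "x \<in> {u'<..<v'}"
    using x \<epsilon>(2) \<delta>_le unfolding greaterThanLessThan_iff by linarith+
  have "K > 0"
    using uv by (simp add: K_def)
  have "(1 - t) * t ^ q \<le> K * \<bar>Delta x - Delta \<alpha>\<bar>"
    using ge unfolding K_def t_def
    by (rule order_trans[OF _ Delta_difference_bounds(2)]) (use uv x_in \<alpha> in auto)
  also have "\<dots> \<le> K * (C * \<epsilon> powr \<zeta>)"
    using C(3)[OF x_in(2)] x \<open>K > 0\<close> by (intro mult_left_mono) auto
  \<comment> \<open>The factor \<open>(l powr \<zeta>) ^ q\<close> is the reciprocal of
    \<open>\<epsilon> powr \<zeta>\<close>.\<close>
  finally have "(1 - t) * t ^ q * (l powr \<zeta>) ^ q \<le> K * (C * \<epsilon> powr \<zeta>) * (l powr \<zeta>) ^ q"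
    using assms by (intro mult_right_mono) auto
  also have "\<epsilon> powr \<zeta> = 1 / (l powr \<zeta>) ^ q"
    using assms by (simp add: \<epsilon>_def power_one_over powr_divide power_powr_swap)
  finally have "(1 - t) * B ^ q \<le> K * C"
    using assms by (simp add: B_def power_mult_distrib mult_ac)
  then show False
    using q(3) t by (simp add: field_simps)
qed

text \<open>A finite exponent bounds the distance of q \<alpha> to the integers below by a power of
  q, and l^q / q outgrows every power of q when l > 1.\<close>

lemma irrationality_base_le_1_if_not_liouville:
  assumes "\<alpha> \<notin> \<rat>" "\<not> liouville \<alpha>"
  shows "irrationality_base \<alpha> \<le> 1"
proof (rule ccontr)
  assume "\<not> irrationality_base \<alpha> \<le> 1"
  then obtain l :: real where l: "1 < l"
    and lim: "liminf (\<lambda>q::nat. ereal (l ^ q / real q * dist_int (real q * \<alpha>))) = 0"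
    unfolding irrationality_base_def by (auto simp: not_le less_SUP_iff)
  have "irrationality_exponent \<alpha> < \<infinity>"
    using assms by (simp add: liouville_def)
  then obtain \<nu> where \<nu>: "irrationality_exponent \<alpha> < ereal \<nu>"
    using ereal_dense2 by blast
  let ?g = "\<lambda>q::nat. real q powr (\<nu> - 1) * dist_int (real q * \<alpha>)"
  have "liminf (\<lambda>q. ereal (?g q)) \<noteq> 0"
  proof
    assume "liminf (\<lambda>q. ereal (?g q)) = 0"
    then have "ereal \<nu> \<le> irrationality_exponent \<alpha>"
      unfolding irrationality_exponent_def by (intro SUP_upper) auto
    then show False
      using \<nu> by simp
  qed
  then obtain e where e: "e > 0" "\<forall>\<^sub>F q in sequentially. e \<le> ?g q"
    using liminf_nonzero_iff[of ?g] by auto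
  have "\<forall>\<^sub>F q in sequentially. real q powr (\<nu> - 1) \<le> l ^ q / real q"
    using l by real_asymp
  with e(2) have "\<forall>\<^sub>F q in sequentially. e \<le> l ^ q / real q * dist_int (real q * \<alpha>)"
  proof eventually_elim
    case (elim q)
    show ?case
      using elim(1) mult_right_mono[OF elim(2) dist_int_nonneg] by (rule order_trans)
  qed
  then show False
    using lim e(1) liminf_nonzero_iff[of "\<lambda>q. l ^ q / real q * dist_int (real q * \<alpha>)"] l by auto
qed

theorem theorem4p15:
  fixes \<alpha>\<^sub>0 :: real
  assumes "\<alpha>\<^sub>0 > 0" and "\<alpha>\<^sub>0 \<notin> \<rat>"
  shows "(\<not> liouville \<alpha>\<^sub>0 \<or> hypo_exponential_liouville \<alpha>\<^sub>0 \<longrightarrow>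
            lipschitz_condition_at \<infinity> Delta \<alpha>\<^sub>0) \<and>
         (1 < irrationality_base \<alpha>\<^sub>0 \<and> irrationality_base \<alpha>\<^sub>0 < ereal (Delta \<alpha>\<^sub>0) \<longrightarrow>
            lipschitz_condition_at
              (ereal (ln (Delta \<alpha>\<^sub>0) / ln (real_of_ereal (irrationality_base \<alpha>\<^sub>0)))) Delta \<alpha>\<^sub>0)"
proof (intro conjI impI)
  let ?E = "hoelder_exponents Delta \<alpha>\<^sub>0"
  have "\<alpha>\<^sub>0 \<notin> \<int>"
    using assms Ints_subset_Rats by auto
  then have Delta1: "Delta \<alpha>\<^sub>0 > 1"
    using Delta_properties(1)[OF assms(1)] assms by simp
  {
    assume "\<not> liouville \<alpha>\<^sub>0 \<or> hypo_exponential_liouville \<alpha>\<^sub>0"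
    then have le: "irrationality_base \<alpha>\<^sub>0 \<le> 1"
      using irrationality_base_le_1_if_not_liouville[OF assms(2)]
      by (auto simp: hypo_exponential_liouville_def)
    \<comment> \<open>Every root of Delta \<alpha>_0 > 1 exceeds 1, hence the irrationality base, so
      no positive exponent is excluded.\<close>
    have "\<zeta> \<in> ?E" if "\<zeta> > 0" for \<zeta>
    proof (rule hoelder_exponent_Delta[OF assms that])
      have "1 < Delta \<alpha>\<^sub>0 powr (1 / \<zeta>)"
        using Delta1 that by (intro gr_one_powr) auto
      then show "irrationality_base \<alpha>\<^sub>0 < ereal (Delta \<alpha>\<^sub>0 powr (1 / \<zeta>))"
        using le by (simp add: one_ereal_def le_less_trans)
    qed
    then have "\<exists>\<zeta>\<in>?E. ereal (real n) \<le> ereal \<zeta>" for n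
      by (intro bexI[of _ "real n + 1"]) auto
    then have "(SUP \<zeta>\<in>?E. ereal \<zeta>) = \<infinity>"
      by (rule SUP_PInfty)
    then show "lipschitz_condition_at \<infinity> Delta \<alpha>\<^sub>0"
      by (simp add: lipschitz_condition_at_iff)
  next
    assume *: "1 < irrationality_base \<alpha>\<^sub>0 \<and> irrationality_base \<alpha>\<^sub>0 < ereal (Delta \<alpha>\<^sub>0)"
    then obtain \<theta> where base: "irrationality_base \<alpha>\<^sub>0 = ereal \<theta>"
      by (cases "irrationality_base \<alpha>\<^sub>0") auto
    then have \<theta>: "1 < \<theta>"
      using * by simp
    define \<eta> where "\<eta> = ln (Delta \<alpha>\<^sub>0) / ln \<theta>"
    have "\<eta> > 0"
      using \<theta> Delta1 by (simp add: \<eta>_def)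
    \<comment> \<open>The threshold \<eta> is the exponent at which Delta \<alpha>_0^(1/\<zeta>)
      equals \<theta>, and this power decreases in \<zeta>.\<close>
    have root_less_iff: "Delta \<alpha>\<^sub>0 powr (1 / \<zeta>) < \<theta> \<longleftrightarrow> \<eta> < \<zeta>"
        "\<theta> < Delta \<alpha>\<^sub>0 powr (1 / \<zeta>) \<longleftrightarrow> \<zeta> < \<eta>" if "\<zeta> > 0" for \<zeta>
    proof -
      have ln: "ln (Delta \<alpha>\<^sub>0 powr (1 / \<zeta>)) = ln (Delta \<alpha>\<^sub>0) / \<zeta>"
        by (simp add: ln_powr)
      have pos: "0 < Delta \<alpha>\<^sub>0 powr (1 / \<zeta>)" "0 < ln \<theta>"
        using Delta1 \<theta> by auto
      show "Delta \<alpha>\<^sub>0 powr (1 / \<zeta>) < \<theta> \<longleftrightarrow> \<eta> < \<zeta>"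
        using ln_less_cancel_iff[of "Delta \<alpha>\<^sub>0 powr (1 / \<zeta>)" \<theta>] pos \<theta> that
        unfolding ln \<eta>_def by (simp add: field_simps)
      show "\<theta> < Delta \<alpha>\<^sub>0 powr (1 / \<zeta>) \<longleftrightarrow> \<zeta> < \<eta>"
        using ln_less_cancel_iff[of \<theta> "Delta \<alpha>\<^sub>0 powr (1 / \<zeta>)"] pos \<theta> that
        unfolding ln \<eta>_def by (simp add: field_simps)
    qed
    have "(SUP \<zeta>\<in>?E. ereal \<zeta>) = ereal \<eta>"
    proof (rule antisym)
      show "(SUP \<zeta>\<in>?E. ereal \<zeta>) \<le> ereal \<eta>"
      proof (intro SUP_least, rule ccontr)
        fix \<zeta>
        assume \<zeta>: "\<zeta> \<in> ?E" and "\<not> ereal \<zeta> \<le> ereal \<eta>"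
        then have "\<eta> < \<zeta>" "\<zeta> > 0"
          using \<open>\<eta> > 0\<close> by auto
        then have "ereal (Delta \<alpha>\<^sub>0 powr (1 / \<zeta>)) < irrationality_base \<alpha>\<^sub>0"
          using root_less_iff base by simp
        \<comment> \<open>Here l is taken from the set behind the supremum, so its lower limit is 0
          without any monotonicity argument in l.\<close>
        then obtain l :: real where l: "Delta \<alpha>\<^sub>0 powr (1 / \<zeta>) < l"
          and lim: "liminf (\<lambda>q::nat. ereal (l ^ q / real q * dist_int (real q * \<alpha>\<^sub>0))) = 0"
          unfolding irrationality_base_def by (auto simp: less_SUP_iff)
        have "1 < Delta \<alpha>\<^sub>0 powr (1 / \<zeta>)"
          using Delta1 \<open>\<zeta> > 0\<close> by (intro gr_one_powr) auto
        then have "l powr \<zeta> \<le> Delta \<alpha>\<^sub>0"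
          using hoelder_exponent_Delta_bound[OF assms \<open>\<zeta> > 0\<close> \<zeta> _ lim] l by simp
        moreover have "(Delta \<alpha>\<^sub>0 powr (1 / \<zeta>)) powr \<zeta> < l powr \<zeta>"
          using l \<open>\<zeta> > 0\<close> by (intro powr_less_mono2) auto
        ultimately show False
          using \<open>\<zeta> > 0\<close> Delta1 by (simp add: powr_powr)
      qed
      show "ereal \<eta> \<le> (SUP \<zeta>\<in>?E. ereal \<zeta>)"
      proof (rule ccontr)
        assume "\<not> ereal \<eta> \<le> (SUP \<zeta>\<in>?E. ereal \<zeta>)"
        \<comment> \<open>The maximum with 0 yields a positive \<zeta>, as
          \<open>hoelder_exponent_Delta\<close> demands.\<close>
        then have "max 0 (SUP \<zeta>\<in>?E. ereal \<zeta>) < ereal \<eta>"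
          using \<open>\<eta> > 0\<close> by simp
        then obtain \<zeta> where "max 0 (SUP \<zeta>\<in>?E. ereal \<zeta>) < ereal \<zeta>" "ereal \<zeta> < ereal \<eta>"
          using ereal_dense2 by blast
        then have \<zeta>: "\<zeta> > 0" "\<zeta> < \<eta>" "(SUP \<zeta>\<in>?E. ereal \<zeta>) < ereal \<zeta>"
          by auto
        then have "\<zeta> \<in> ?E"
          using root_less_iff base by (intro hoelder_exponent_Delta assms) auto
        then have "ereal \<zeta> \<le> (SUP \<zeta>\<in>?E. ereal \<zeta>)"
          by (rule SUP_upper)
        then show False
          using \<zeta> by simp
      qed
    qed
    then show "lipschitz_condition_at
        (ereal (ln (Delta \<alpha>\<^sub>0) / ln (real_of_ereal (irrationality_base \<alpha>\<^sub>0)))) Delta \<alpha>\<^sub>0"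
      by (simp add: lipschitz_condition_at_iff base \<eta>_def)
  }
qed

end
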